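(* Let $L,K$ be strictly concave kernel functions such that either $K$ satisfies condition $(\infty')$, or both $K$ and $L$ belong to $\mathrm{C}^1(0,2\pi)$. For $\mathbf{y}=(y_1,\dots,y_n)\in\mathbb{T}^n$ set $F(\mathbf{y},t)=L(t)+\sum_{j=1}^nK(t-y_j)$. Then there is a $\mathbf{w}^*=(w_1,\dots,w_n)\in\mathbb{T}^n$, unique up to permutation of its coordinates, with \[M:=\inf_{\mathbf{y}\in\mathbb{T}^n}\sup_{t\in\mathbb{T}}F(\mathbf{y},t)=\sup_{t\in\mathbb{T}}F(\mathbf{w}^*,t).\] Moreover: (a) the nodes $w_0=0,w_1,\dots,w_n$ are pairwise different and $\mathbf{w}^*$ is an equioscillation point, $m_0(\mathbf{w}^* )=\dots=m_n(\mathbf{w}^* )$; (b) $M=\inf_{\mathbf{y}\in\mathbb{T}^n}\max_{j=0,\dots,n}\sup_{t\in I_j(\mathbf{y})}F(\mathbf{y},t)=\sup_{\mathbf{y}\in\mathbb{T}^n}\min_{j=0,\dots,n}\sup_{t\in I_j(\mathbf{y})}F(\mathbf{y},t)=m$; (c) the Sandwich Property holds on $\mathbb{T}^n$: for all $\mathbf{x},\mathbf{y}\in\mathbb{T}^n$, $\underline{m}(\mathbf{x})\le m=M\le\overline{m}(\mathbf{y})$; (d) if moreover $L=K$, then the points $w_0=0,w_1,\dots,w_n$ are, after a permutation, equidistantly spaced in $\mathbb{T}$.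
   Context: Identify the torus $\mathbb{T}=\mathbb{R}/2\pi\mathbb{Z}$ with $[0,2\pi)$. A concave kernel function is a $2\pi$-periodic function $K:\mathbb{R}\to[-\infty,\infty)$ which is real-valued and concave on $(0,2\pi)$ and such that $\lim_{t\downarrow0}K(t)$ and $\lim_{t\uparrow2\pi}K(t)$ exist in $[-\infty,\infty)$ and are equal; it is strictly concave if strictly concave on $(0,2\pi)$. $D_\pm$ denote one-sided derivatives. Condition $(\infty')$ for $K$: either $\lim_{t\uparrow2\pi}D_-K(t)=\lim_{t\uparrow2\pi}D_+K(t)=-\infty$, or $\lim_{t\downarrow0}D_-K(t)=\lim_{t\downarrow0}D_+K(t)=+\infty$. For $\mathbf{y}\in\mathbb{T}^n$ put $y_0=0$, $y_{n+1}=2\pi$. For a permutation $\sigma$ of $\{1,\dots,n\}$ (with $\sigma(0)=0,\sigma(n+1)=n+1$) the closed simplex $\overline{S_\sigma}$ is the set of $\mathbf{y}$ with $0\le y_{\sigma(1)}\le\dots\le y_{\sigma(n)}\le2\pi$; for such $\mathbf{y}$ and $k=0,\dots,n$, $I_{\sigma(k)}(\mathbf{y})=[y_{\sigma(k)},y_{\sigma(k+1)}]$ and $m_{\sigma(k)}(\mathbf{y})=\sup_{t\in I_{\sigma(k)}(\mathbf{y})}F(\mathbf{y},t)$. For each $\mathbf{y}$ some $\sigma$ with $\mathbf{y}\in\overline{S_\sigma}$ is chosen; the quantities $\overline{m}(\mathbf{y})=\max_jm_j(\mathbf{y})=\sup_{t\in\mathbb{T}}F(\mathbf{y},t)$ and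 $\underline{m}(\mathbf{y})=\min_jm_j(\mathbf{y})$ do not depend on this choice. $m:=\sup_{\mathbf{y}\in\mathbb{T}^n}\underline{m}(\mathbf{y})$. An equioscillation point is a $\mathbf{y}$ with $m_0(\mathbf{y})=\dots=m_n(\mathbf{y})$.
   Formalization: The values K(0) and L(0) are required to equal the common one-sided limits at 0 and 2π; with an arbitrary value at 0 (e.g. K=L=-(t-π)² on (0,2π), K(0)=100, n=1) the infimum M need not be attained. *)

theory Defs
  imports "HOL-Analysis.Analysis" "HOL-Library.Extended_Real"
begin

definition strictly_concave_on :: "real set \<Rightarrow> (real \<Rightarrow> real) \<Rightarrow> bool" where
  "strictly_concave_on S f \<longleftrightarrow> convex S \<and>
     (\<forall>x\<in>S. \<forall>y\<in>S. x \<noteq> y \<longrightarrow> (\<forall>u::real. 0 < u \<and> u < 1 \<longrightarrow>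
        f ((1 - u) * x + u * y) > (1 - u) * f x + u * f y))"

text \<open>Concave kernel function K : R -> [-infinity, infinity), modelled as an ereal-valued
  function never taking the value +infinity.  The value at 0 (= 2 pi mod 2 pi) is the common
  one-sided limit.\<close>
definition concave_kernel :: "(real \<Rightarrow> ereal) \<Rightarrow> bool" where
  "concave_kernel K \<longleftrightarrow>
     (\<forall>t. K (t + 2 * pi) = K t) \<and>
     (\<forall>t. K t \<noteq> \<infinity>) \<and>
     (\<forall>t\<in>{0<..<2 * pi}. K t \<noteq> - \<infinity>) \<and>
     concave_on {0<..<2 * pi} (\<lambda>t. real_of_ereal (K t)) \<and>
     (K \<longlongrightarrow> K 0) (at_right 0) \<and> (K \<longlongrightarrow> K 0) (at_left (2 * pi))"

definition strictly_concave_kernel :: "(real \<Rightarrow> ereal) \<Rightarrow> bool" where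
  "strictly_concave_kernel K \<longleftrightarrow> concave_kernel K \<and>
     strictly_concave_on {0<..<2 * pi} (\<lambda>t. real_of_ereal (K t))"

definition right_deriv :: "(real \<Rightarrow> real) \<Rightarrow> real \<Rightarrow> real" where
  "right_deriv f t = Lim (at_right 0) (\<lambda>h. (f (t + h) - f t) / h)"

definition left_deriv :: "(real \<Rightarrow> real) \<Rightarrow> real \<Rightarrow> real" where
  "left_deriv f t = Lim (at_left 0) (\<lambda>h. (f (t + h) - f t) / h)"

definition cond_infty' :: "(real \<Rightarrow> ereal) \<Rightarrow> bool" where
  "cond_infty' K \<longleftrightarrow>
     (let k = (\<lambda>t. real_of_ereal (K t)) in
       (filterlim (left_deriv k) at_bot (at_left (2 * pi)) \<and>
        filterlim (right_deriv k) at_bot (at_left (2 * pi))) \<or>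
       (filterlim (left_deriv k) at_top (at_right 0) \<and>
        filterlim (right_deriv k) at_top (at_right 0)))"

definition C1_on_open_period :: "(real \<Rightarrow> ereal) \<Rightarrow> bool" where
  "C1_on_open_period K \<longleftrightarrow>
     (\<exists>k'. (\<forall>t\<in>{0<..<2 * pi}. ((\<lambda>s. real_of_ereal (K s)) has_real_derivative k' t) (at t)) \<and>
           continuous_on {0<..<2 * pi} k')"

definition torus_pts :: "nat \<Rightarrow> real list set" where
  "torus_pts n = {y. length y = n \<and> set y \<subseteq> {0..<2 * pi}}"

definition Ffun :: "(real \<Rightarrow> ereal) \<Rightarrow> (real \<Rightarrow> ereal) \<Rightarrow> real list \<Rightarrow> real \<Rightarrow> ereal" where
  "Ffun L K y t = L t + (\<Sum>j<length y. K (t - y ! j))"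

text \<open>Nodes 0 = y_sigma(0) <= y_sigma(1) <= ... <= y_sigma(n) <= y_sigma(n+1) = 2 pi.\<close>
definition nodes :: "real list \<Rightarrow> real list" where
  "nodes y = 0 # sort y @ [2 * pi]"

text \<open>m_{sigma(k)}(y) = sup of F(y,.) on I_{sigma(k)}(y) = [y_sigma(k), y_sigma(k+1)], k = 0..n.\<close>
definition interval_max :: "(real \<Rightarrow> ereal) \<Rightarrow> (real \<Rightarrow> ereal) \<Rightarrow> real list \<Rightarrow> nat \<Rightarrow> ereal" where
  "interval_max L K y k = (SUP t\<in>{nodes y ! k .. nodes y ! (k + 1)}. Ffun L K y t)"

definition m_upper :: "(real \<Rightarrow> ereal) \<Rightarrow> (real \<Rightarrow> ereal) \<Rightarrow> real list \<Rightarrow> ereal" where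
  "m_upper L K y = Max (interval_max L K y ` {0..length y})"

definition m_lower :: "(real \<Rightarrow> ereal) \<Rightarrow> (real \<Rightarrow> ereal) \<Rightarrow> real list \<Rightarrow> ereal" where
  "m_lower L K y = Min (interval_max L K y ` {0..length y})"

definition m_val :: "(real \<Rightarrow> ereal) \<Rightarrow> (real \<Rightarrow> ereal) \<Rightarrow> nat \<Rightarrow> ereal" where
  "m_val L K n = (SUP y\<in>torus_pts n. m_lower L K y)"

definition M_val :: "(real \<Rightarrow> ereal) \<Rightarrow> (real \<Rightarrow> ereal) \<Rightarrow> nat \<Rightarrow> ereal" where
  "M_val L K n = (INF y\<in>torus_pts n. SUP t. Ffun L K y t)"

end

theory Submission
  imports Defs
begin

text \<open>
  On each node interval \<open>F(y, t)\<close> is jointly concave in \<open>(y, t)\<close>, so the interval maxima \<open>m\<^sub>j\<close> are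
  strictly concave functions of the sorted nodes. Let \<open>w\<close> minimize the global maximum, with value
  \<open>M\<close>. No maximum point of \<open>F(w, \<cdot>)\<close> is a node of \<open>K\<close>, so for every nondegenerate interval carrying
  the maximum there is a supergradient \<open>- \<kappa>\<^sub>j\<close> of \<open>m\<^sub>j\<close> at \<open>w\<close>. A direction \<open>v \<noteq> 0\<close> with \<open>\<kappa>\<^sub>j \<bullet> v \<ge> 0\<close> for all
  these \<open>j\<close> would, by strict concavity, strictly lower the maximum. At most \<open>n\<close> vectors in an
  \<open>n\<close>-dimensional space always admit such a direction; hence all \<open>n + 1\<close> intervals are
  nondegenerate and carry the maximum, and the \<open>\<kappa>\<^sub>j\<close> satisfy a relation \<open>\<Sum>\<^sub>j l\<^sub>j \<kappa>\<^sub>j = 0\<close> with \<open>l \<ge> 0\<close>,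
  \<open>l \<noteq> 0\<close>. Averaging the tangent inequalities with the weights \<open>l\<close> gives \<open>min\<^sub>j m\<^sub>j(x) < M\<close> for every
  \<open>x \<noteq> w\<close>, which contains uniqueness and the sandwich property. If \<open>L = K\<close>, the equidistant
  configuration equioscillates and must therefore be \<open>w\<close>.
\<close>

section \<open>Linear systems and supergradients\<close>

text \<open>Gaussian elimination by induction on the equations: one equation with a nonzero
  coefficient is used to eliminate one unknown, so that both counts drop by one.\<close>

lemma underdetermined_system_nontrivial:
  fixes a :: "'j \<Rightarrow> 'i \<Rightarrow> real"
  assumes "finite J" "finite I" "card J < card I"
  shows "\<exists>v. (\<exists>i\<in>I. v i \<noteq> 0) \<and> (\<forall>j\<in>J. (\<Sum>i\<in>I. a j i * v i) = 0)"
  using assms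
proof (induction J arbitrary: I a rule: finite_induct)
  case empty
  then obtain i where "i \<in> I" by fastforce
  then show ?case by (intro exI[of _ "\<lambda>_. 1"]) auto
next
  case (insert j0 J)
  show ?case
  proof (cases "\<forall>i\<in>I. a j0 i = 0")
    case True
    from insert.IH[of I a] insert.prems insert.hyps obtain v where
      "\<exists>i\<in>I. v i \<noteq> 0" "\<forall>j\<in>J. (\<Sum>i\<in>I. a j i * v i) = 0" by auto
    then show ?thesis using True by (intro exI[of _ v]) auto
  next
    case False
    then obtain i0 where i0: "i0 \<in> I" "a j0 i0 \<noteq> 0" by auto
    \<comment> \<open>Row \<open>j\<close> minus the multiple of row \<open>j0\<close> that cancels
      the unknown \<open>i0\<close>.\<close>
    define b where "b j i = a j i - a j i0 * a j0 i / a j0 i0" for j i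
    have "card J < card (I - {i0})" using insert i0 by auto
    from insert.IH[of "I - {i0}" b, OF _ this] insert.prems obtain v where
      v: "\<exists>i\<in>I - {i0}. v i \<noteq> 0" "\<And>j. j \<in> J \<Longrightarrow> (\<Sum>i\<in>I - {i0}. b j i * v i) = 0" by auto
    define S where "S j = (\<Sum>i\<in>I - {i0}. a j i * v i)" for j
    \<comment> \<open>The eliminated unknown gets the value that solves equation
      \<open>j0\<close>.\<close>
    define v' where "v' = v(i0 := - S j0 / a j0 i0)"
    have sum': "(\<Sum>i\<in>I. a j i * v' i) = S j - a j i0 * S j0 / a j0 i0" for j
    proof -
      have "(\<Sum>i\<in>I. a j i * v' i) = a j i0 * v' i0 + (\<Sum>i\<in>I - {i0}. a j i * v' i)"
        using i0 insert.prems by (simp add: sum.remove)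
      also have "(\<Sum>i\<in>I - {i0}. a j i * v' i) = S j"
        unfolding S_def v'_def by (rule sum.cong) auto
      finally show ?thesis by (simp add: v'_def)
    qed
    have "(\<Sum>i\<in>I - {i0}. b j i * v i) = S j - a j i0 * S j0 / a j0 i0" for j
      by (simp add: b_def S_def sum_subtractf left_diff_distrib sum_distrib_left
          sum_divide_distrib mult.assoc)
    then have "\<forall>j\<in>insert j0 J. (\<Sum>i\<in>I. a j i * v' i) = 0"
      using sum' v(2) i0 by auto
    moreover have "\<exists>i\<in>I. v' i \<noteq> 0" using v(1) by (auto simp: v'_def)
    ultimately show ?thesis by blast
  qed
qed

text \<open>All inequalities but one can be made equalities by a nonzero vector; its sign is still
  free and settles the remaining one.\<close>

lemma few_halfspaces_common_direction:
  fixes a :: "'j \<Rightarrow> 'i \<Rightarrow> real"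
  assumes "finite J" "finite I" "card J \<le> card I" "I \<noteq> {}"
  shows "\<exists>v. (\<exists>i\<in>I. v i \<noteq> 0) \<and> (\<forall>j\<in>J. (\<Sum>i\<in>I. a j i * v i) \<ge> 0)"
proof (cases "J = {}")
  case True
  then show ?thesis using assms by (intro exI[of _ "\<lambda>_. 1"]) auto
next
  case False
  then obtain j0 where j0: "j0 \<in> J" by auto
  have "card (J - {j0}) < card I"
    using assms j0 by (metis card_Diff1_less dual_order.strict_trans1 order_le_less)
  then obtain v where v: "\<exists>i\<in>I. v i \<noteq> 0"
      "\<And>j. j \<in> J - {j0} \<Longrightarrow> (\<Sum>i\<in>I. a j i * v i) = 0"
    using underdetermined_system_nontrivial[of "J - {j0}" I a] assms by auto
  define s where "s = (if (\<Sum>i\<in>I. a j0 i * v i) \<ge> 0 then 1 else - 1 :: real)"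
  have "(\<Sum>i\<in>I. a j i * (s * v i)) = s * (\<Sum>i\<in>I. a j i * v i)" for j
    by (simp add: sum_distrib_left mult_ac)
  moreover have "s * (\<Sum>i\<in>I. a j i * v i) \<ge> 0" if "j \<in> J" for j
    using v(2)[of j] that by (cases "j = j0") (auto simp: s_def)
  ultimately have "\<forall>j\<in>J. (\<Sum>i\<in>I. a j i * (s * v i)) \<ge> 0" by simp
  moreover have "\<exists>i\<in>I. s * v i \<noteq> 0" using v(1) by (auto simp: s_def)
  ultimately show ?thesis by (intro exI[of _ "\<lambda>i. s * v i"] conjI)
qed

text \<open>A nontrivial relation \<open>l\<close> exists by counting. If \<open>l\<close> had both
  signs, say at \<open>p\<close> and \<open>q\<close>, a nonzero \<open>v\<close> annihilating all
  rows except these two would have, up to its sign, nonnegative products with every row, against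
  \<open>no\<close>. Hence \<open>l\<close> or its negative is nonnegative.\<close>

lemma no_common_direction_imp_positive_relation:
  fixes a :: "'j \<Rightarrow> 'i \<Rightarrow> real"
  assumes fin: "finite J" "finite I" and card: "card J = Suc (card I)"
    and no: "\<And>v. \<exists>i\<in>I. v i \<noteq> 0 \<Longrightarrow> \<exists>j\<in>J. (\<Sum>i\<in>I. a j i * v i) < 0"
  shows "\<exists>l. (\<forall>j\<in>J. l j \<ge> 0) \<and> (\<exists>j\<in>J. l j > 0) \<and> (\<forall>i\<in>I. (\<Sum>j\<in>J. l j * a j i) = 0)"
proof -
  obtain l where l: "\<exists>j\<in>J. l j \<noteq> 0" "\<And>i. i \<in> I \<Longrightarrow> (\<Sum>j\<in>J. l j * a j i) = 0"
    using underdetermined_system_nontrivial[of I J "\<lambda>i j. a j i"] fin card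
    by (auto simp: mult.commute)
  have same_sign: False if pq: "p \<in> J" "q \<in> J" "l p > 0" "l q < 0" for p q
  proof -
    have pq': "p \<noteq> q" using pq by auto
    have "card (J - {p, q}) < card I"
    proof -
      have "card {p, q} \<le> card J" using pq fin by (intro card_mono) auto
      then show ?thesis using pq pq' card fin by (simp add: card_Diff_subset)
    qed
    then obtain v where v: "\<exists>i\<in>I. v i \<noteq> 0"
        "\<And>j. j \<in> J - {p, q} \<Longrightarrow> (\<Sum>i\<in>I. a j i * v i) = 0"
      using underdetermined_system_nontrivial[of "J - {p, q}" I a] fin by auto
    define A where "A j = (\<Sum>i\<in>I. a j i * v i)" for j
    have "(\<Sum>j\<in>J. l j * A j) = (\<Sum>i\<in>I. (\<Sum>j\<in>J. l j * a j i) * v i)"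
      unfolding A_def sum_distrib_left sum_distrib_right
      by (subst sum.swap) (simp add: mult_ac)
    also have "\<dots> = 0" using l(2) by simp
    finally have "(\<Sum>j\<in>J. l j * A j) = 0" .
    moreover have "(\<Sum>j\<in>J. l j * A j) = (\<Sum>j\<in>{p, q}. l j * A j)"
      using pq v(2) fin by (intro sum.mono_neutral_right) (auto simp: A_def)
    ultimately have eq: "l p * A p + l q * A q = 0" using pq' by simp
    \<comment> \<open>Since \<open>l p\<close> and \<open>- l q\<close> are positive and
      \<open>l p * A p = - l q * A q\<close>, the values \<open>A p\<close> and \<open>A q\<close>
      never have opposite signs; the factor \<open>s\<close> makes both nonnegative.\<close>
    define s where "s = (if A p \<ge> 0 then 1 else - 1 :: real)"
    have "s * A p \<ge> 0" by (auto simp: s_def)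
    have "l p * (s * A p) = - l q * (s * A q)"
    proof -
      have "s * (l p * A p + l q * A q) = 0" using eq by simp
      then show ?thesis by (simp add: distrib_left mult.left_commute)
    qed
    then have "- l q * (s * A q) \<ge> 0" using \<open>s * A p \<ge> 0\<close> pq(3)
      by (metis less_imp_le mult_nonneg_nonneg)
    then have "s * A q \<ge> 0" using pq(4) by (simp add: mult_le_0_iff)
    have "(\<Sum>i\<in>I. a j i * (s * v i)) = s * A j" for j
      by (simp add: A_def sum_distrib_left mult_ac)
    moreover have "\<exists>i\<in>I. s * v i \<noteq> 0" using v(1) by (auto simp: s_def)
    then obtain j where "j \<in> J" "(\<Sum>i\<in>I. a j i * (s * v i)) < 0" using no[of "\<lambda>i. s * v i"] by blast
    ultimately have "j \<in> J" "s * A j < 0" by auto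
    then show False using \<open>s * A p \<ge> 0\<close> \<open>s * A q \<ge> 0\<close> v(2)[of j] by (cases "j \<in> {p, q}") (auto simp: A_def)
  qed
  show ?thesis
  proof (cases "\<exists>p\<in>J. l p > 0")
    case True
    then have "\<forall>j\<in>J. l j \<ge> 0" using same_sign by (meson not_le)
    then show ?thesis using True l(2) by blast
  next
    case False
    then have "\<forall>j\<in>J. - l j \<ge> 0" by (auto simp: not_less)
    moreover have "\<exists>j\<in>J. - l j > 0" using l(1) False by (metis neg_0_less_iff_less linorder_neqE_linordered_idom)
    ultimately show ?thesis using l(2) by (intro exI[of _ "\<lambda>j. - l j"]) (auto simp: sum_negf)
  qed
qed

section \<open>Slopes and supergradients of concave functions of one variable\<close>

lemma concave_on_realI:
  fixes f :: "real \<Rightarrow> real"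
  assumes "convex S"
    and "\<And>x y u. x \<in> S \<Longrightarrow> y \<in> S \<Longrightarrow> 0 \<le> u \<Longrightarrow> u \<le> 1 \<Longrightarrow>
           (1 - u) * f x + u * f y \<le> f ((1 - u) * x + u * y)"
  shows "concave_on S f"
  unfolding concave_on_iff
proof (intro conjI ballI allI impI assms(1))
  fix x y u v assume *: "x \<in> S" "y \<in> S" "0 \<le> u" "0 \<le> v" "u + v = (1::real)"
  then have u: "u = 1 - v" by simp
  show "u * f x + v * f y \<le> f (u *\<^sub>R x + v *\<^sub>R y)" using assms(2)[of x y v] * unfolding u by simp
qed

lemma concave_on_slope_le:
  fixes f :: "real \<Rightarrow> real"
  assumes "concave_on A f" "x \<in> A" "z \<in> A" "x < y" "y < z"
  shows "(f z - f x) / (z - x) \<le> (f y - f x) / (y - x)"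
    and "(f z - f y) / (z - y) \<le> (f z - f x) / (z - x)"
proof -
  have c: "convex_on A (\<lambda>t. - f t)" using assms by (simp add: concave_on_def)
  show "(f z - f x) / (z - x) \<le> (f y - f x) / (y - x)"
    using convex_on_slope_le(1)[OF c assms(2,3,4,5)] assms(4,5) by (simp add: field_simps)
  show "(f z - f y) / (z - y) \<le> (f z - f x) / (z - x)"
    using convex_on_slope_le(2)[OF c assms(2,3,4,5)] assms(4,5) by (simp add: field_simps)
qed

lemma concave_on_slope_antimono:
  fixes f :: "real \<Rightarrow> real"
  assumes c: "concave_on A f" and z: "z \<in> A" and rs: "r \<in> A" "s \<in> A" "r \<le> s" "r \<noteq> z" "s \<noteq> z"
  shows "(f s - f z) / (s - z) \<le> (f r - f z) / (r - z)"
proof -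
  have flip: "(f a - f b) / (a - b) = (f b - f a) / (b - a)" for a b
    by (metis minus_diff_eq minus_divide_divide)
  consider "r = s" | "r < s" "z < r" | "r < s" "s < z" | "r < z" "z < s" using rs by force
  then show ?thesis
  proof cases
    case 2 then show ?thesis using concave_on_slope_le(1)[OF c z rs(2), of r] by simp
  next
    case 3 then show ?thesis using concave_on_slope_le(2)[OF c rs(1) z, of s] by (metis flip)
  next
    case 4 then show ?thesis using concave_on_slope_le[OF c rs(1,2), of z] by (metis flip order.trans)
  qed auto
qed

text \<open>The slope \<open>\<kappa>\<close> is a cut between two sets of difference quotients; every required comparison
  reduces to a point of \<open>A \<inter> B\<close> near \<open>z\<close>.\<close>
lemma concave_sum_max_supergradient:
  fixes f g :: "real \<Rightarrow> real"
  assumes f: "concave_on A f" and g: "concave_on B g" and B: "open B" and z: "z \<in> A" "z \<in> B"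
    and max: "\<And>r. r \<in> A \<Longrightarrow> r \<in> B \<Longrightarrow> f r + g r \<le> f z + g z"
  shows "\<exists>\<kappa>. (\<forall>r\<in>A. f r \<le> f z - \<kappa> * (r - z)) \<and> (\<forall>r\<in>B. g r \<le> g z + \<kappa> * (r - z))"
proof -
  define p where "p r = (f r - f z) / (r - z)" for r
  define q where "q r = (g r - g z) / (r - z)" for r
  have pmono: "p s \<le> p r" if "r \<in> A" "s \<in> A" "r \<le> s" "r \<noteq> z" "s \<noteq> z" for r s
    unfolding p_def using concave_on_slope_antimono[OF f z(1)] that by auto
  have qmono: "q s \<le> q r" if "r \<in> B" "s \<in> B" "r \<le> s" "r \<noteq> z" "s \<noteq> z" for r s
    unfolding q_def using concave_on_slope_antimono[OF g z(2)] that by auto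
  have ivA: "r \<in> A" if "s \<in> A" "z \<le> r \<and> r \<le> s \<or> s \<le> r \<and> r \<le> z" for r s
    using concave_on_imp_convex[OF f] z(1) that
    by (metis is_interval_convex_1 mem_is_interval_1_I)
  have ivB: "r \<in> B" if "s \<in> B" "z \<le> r \<and> r \<le> s \<or> s \<le> r \<and> r \<le> z" for r s
    using concave_on_imp_convex[OF g] z(2) that
    by (metis is_interval_convex_1 mem_is_interval_1_I)
  have pq: "p r + q r = ((f r + g r) - (f z + g z)) / (r - z)" for r
    by (simp add: p_def q_def add_divide_distrib diff_divide_distrib)
  have right: "p r + q r \<le> 0" if "r \<in> A" "r \<in> B" "z < r" for r
    unfolding pq using max[OF that(1,2)] that(3) by (simp add: divide_le_0_iff)
  have left: "p r + q r \<ge> 0" if "r \<in> A" "r \<in> B" "r < z" for r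
    unfolding pq using max[OF that(1,2)] that(3) by (simp add: zero_le_divide_iff)
  define Lo where "Lo = q ` {r\<in>B. z < r} \<union> (\<lambda>s. - p s) ` {s\<in>A. s < z}"
  define Up where "Up = q ` {s\<in>B. s < z} \<union> (\<lambda>r. - p r) ` {r\<in>A. z < r}"
  have cut: "x \<le> y" if "x \<in> Lo" "y \<in> Up" for x y
  proof -
    have 1: "q r \<le> q s" if "r \<in> B" "z < r" "s \<in> B" "s < z" for r s using qmono[of s r] that by auto
    have 2: "q r \<le> - p s" if "r \<in> B" "z < r" "s \<in> A" "z < s" for r s
    proof -
      have "min r s \<in> A" "min r s \<in> B" using ivA[of s "min r s"] ivB[of r "min r s"] that by auto
      then show ?thesis
        using right[of "min r s"] qmono[of "min r s" r] pmono[of "min r s" s] that by fastforce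
    qed
    have 3: "- p r \<le> q s" if "r \<in> A" "r < z" "s \<in> B" "s < z" for r s
    proof -
      have "max r s \<in> A" "max r s \<in> B" using ivA[of r "max r s"] ivB[of s "max r s"] that by auto
      then show ?thesis
        using left[of "max r s"] qmono[of s "max r s"] pmono[of r "max r s"] that by fastforce
    qed
    have 4: "- p r \<le> - p s" if "r \<in> A" "r < z" "s \<in> A" "z < s" for r s using pmono[of r s] that by auto
    show ?thesis using that 1 2 3 4 unfolding Lo_def Up_def by blast
  qed
  \<comment> \<open>The open set \<open>B\<close> has points on both sides of \<open>z\<close>, so
    neither side of the cut is empty even when \<open>z\<close> is an end point of
    \<open>A\<close>.\<close>
  obtain e where e: "e > 0" "ball z e \<subseteq> B" using B z(2) openE by blast
  have "z + e/2 \<in> B" "z - e/2 \<in> B" using e by (auto simp: dist_real_def subset_iff)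
  then have "q (z + e/2) \<in> Lo" "q (z - e/2) \<in> Up" unfolding Lo_def Up_def using e(1) by auto
  then have ne: "Lo \<noteq> {}" "Up \<noteq> {}" by auto
  have bdd: "bdd_above Lo" using cut ne(2) unfolding bdd_above_def by blast
  define \<kappa> where "\<kappa> = Sup Lo"
  have lo: "x \<le> \<kappa>" if "x \<in> Lo" for x unfolding \<kappa>_def using that bdd by (rule cSup_upper)
  have up: "\<kappa> \<le> y" if "y \<in> Up" for y unfolding \<kappa>_def using ne(1) cut that by (intro cSup_least) auto
  have "f r \<le> f z - \<kappa> * (r - z)" if "r \<in> A" for r
  proof -
    consider "r = z" | "r < z" | "z < r" by force
    then show ?thesis
    proof cases
      case 2
      then have "- p r \<le> \<kappa>" using lo that unfolding Lo_def by blast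
      then show ?thesis using 2 by (simp add: p_def field_simps)
    next
      case 3
      then have "\<kappa> \<le> - p r" using up that unfolding Up_def by blast
      then show ?thesis using 3 by (simp add: p_def field_simps)
    qed simp
  qed
  moreover have "g r \<le> g z + \<kappa> * (r - z)" if "r \<in> B" for r
  proof -
    consider "r = z" | "r < z" | "z < r" by force
    then show ?thesis
    proof cases
      case 2
      then have "\<kappa> \<le> q r" using up that unfolding Up_def by blast
      then show ?thesis using 2 by (simp add: q_def field_simps)
    next
      case 3
      then have "q r \<le> \<kappa>" using lo that unfolding Lo_def by blast
      then show ?thesis using 3 by (simp add: q_def field_simps)
    qed simp
  qed
  ultimately show ?thesis by blast
qed

lemma concave_on_restrict:
  assumes "concave_on A f" "convex B" "B \<subseteq> A"
  shows "concave_on B f"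
  using assms by (auto simp: concave_on_def intro: convex_on_subset)

lemma concave_on_sum_family:
  fixes f :: "'i \<Rightarrow> real \<Rightarrow> real"
  assumes "finite I" "convex A" "\<And>i. i \<in> I \<Longrightarrow> concave_on A (f i)"
  shows "concave_on A (\<lambda>x. \<Sum>i\<in>I. f i x)"
  using assms by (induction I rule: finite_induct) (auto simp: concave_on_const intro: concave_on_add)

text \<open>The functions \<open>f i\<close> are split off one at a time: once the slope
  \<open>k0\<close> of one of them is known, it is replaced by its linear part, and \<open>z\<close>
  remains a maximum point. The set \<open>A\<close> need not be open because one kernel may have its
  maximum at an end of the period.\<close>

lemma concave_family_max_supergradients:
  fixes f :: "'i \<Rightarrow> real \<Rightarrow> real" and g :: "real \<Rightarrow> real"
  assumes "finite I" and "concave_on A g" "z \<in> A"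
    and "\<And>i. i \<in> I \<Longrightarrow> open (B i) \<and> concave_on (B i) (f i) \<and> z \<in> B i"
    and "\<And>r. r \<in> A \<Longrightarrow> (\<And>i. i \<in> I \<Longrightarrow> r \<in> B i) \<Longrightarrow> g r + (\<Sum>i\<in>I. f i r) \<le> g z + (\<Sum>i\<in>I. f i z)"
  shows "\<exists>\<kappa>. (\<forall>r\<in>A. g r \<le> g z - (\<Sum>i\<in>I. \<kappa> i) * (r - z)) \<and>
             (\<forall>i\<in>I. \<forall>r\<in>B i. f i r \<le> f i z + \<kappa> i * (r - z))"
  using assms
proof (induction I arbitrary: g rule: finite_induct)
  case empty
  then show ?case by simp
next
  case (insert i0 I)
  define C where "C = A \<inter> (\<Inter>i\<in>I. B i)"
  have convB: "convex (B i)" if "i \<in> I" for i using insert.prems(3)[of i] that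
    by (auto intro: concave_on_imp_convex)
  have convC: "convex C" unfolding C_def
    using concave_on_imp_convex[OF insert.prems(1)] convB by (intro convex_Int convex_INT) auto
  have cC: "concave_on C (\<lambda>r. g r + (\<Sum>i\<in>I. f i r))"
  proof (intro concave_on_add concave_on_sum_family)
    show "concave_on C g" by (rule concave_on_restrict[OF insert.prems(1) convC]) (auto simp: C_def)
    show "concave_on C (f i)" if "i \<in> I" for i
      using insert.prems(3)[of i] that
      by (intro concave_on_restrict[OF _ convC, of "B i"]) (auto simp: C_def)
  qed (use insert convC in auto)
  have "\<exists>\<kappa>. (\<forall>r\<in>C. g r + (\<Sum>i\<in>I. f i r) \<le> g z + (\<Sum>i\<in>I. f i z) - \<kappa> * (r - z)) \<and>
            (\<forall>r\<in>B i0. f i0 r \<le> f i0 z + \<kappa> * (r - z))"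
  proof (rule concave_sum_max_supergradient[OF cC])
    show "concave_on (B i0) (f i0)" "open (B i0)" "z \<in> B i0" using insert.prems(3)[of i0] by auto
    show "z \<in> C" unfolding C_def using insert.prems by auto
    fix r assume "r \<in> C" "r \<in> B i0"
    then show "g r + (\<Sum>i\<in>I. f i r) + f i0 r \<le> g z + (\<Sum>i\<in>I. f i z) + f i0 z"
      using insert.prems(4)[of r] insert.hyps by (auto simp: C_def add_ac)
  qed
  then obtain k0 where k0: "\<And>r. r \<in> C \<Longrightarrow> g r + (\<Sum>i\<in>I. f i r) \<le> g z + (\<Sum>i\<in>I. f i z) - k0 * (r - z)"
    "\<And>r. r \<in> B i0 \<Longrightarrow> f i0 r \<le> f i0 z + k0 * (r - z)" by blast
  \<comment> \<open>The linear part of \<open>f i0\<close> is absorbed into \<open>g\<close>. The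
    bound \<open>k0(1)\<close> says that \<open>z\<close> is still a maximum point, now without the
    restriction to \<open>B i0\<close>, which is what the induction hypothesis requires.\<close>
  define g' where "g' r = g r + k0 * (r - z)" for r
  have "concave_on A g'"
  proof -
    have cA: "convex A" using insert.prems(1) by (rule concave_on_imp_convex)
    have "concave_on A (\<lambda>r. k0 * (r - z))"
      by (rule concave_on_realI[OF cA]) (simp add: algebra_simps)
    then show ?thesis unfolding g'_def using insert.prems(1) by (intro concave_on_add) auto
  qed
  moreover have "g' r + (\<Sum>i\<in>I. f i r) \<le> g' z + (\<Sum>i\<in>I. f i z)"
    if "r \<in> A" "\<And>i. i \<in> I \<Longrightarrow> r \<in> B i" for r
    using k0(1)[of r] that by (auto simp: C_def g'_def)
  ultimately obtain \<kappa> where \<kappa>: "\<forall>r\<in>A. g' r \<le> g' z - (\<Sum>i\<in>I. \<kappa> i) * (r - z)"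
      "\<forall>i\<in>I. \<forall>r\<in>B i. f i r \<le> f i z + \<kappa> i * (r - z)"
    using insert.IH[of g'] insert.prems by auto
  have s: "(\<Sum>i\<in>insert i0 I. (\<kappa>(i0 := k0)) i) = k0 + (\<Sum>i\<in>I. \<kappa> i)"
    using insert.hyps by (simp add: sum.insert) (intro sum.cong; auto)
  show ?case
  proof (intro exI[of _ "\<kappa>(i0 := k0)"] conjI ballI)
    fix r assume "r \<in> A"
    then show "g r \<le> g z - (\<Sum>i\<in>insert i0 I. (\<kappa>(i0 := k0)) i) * (r - z)"
      using \<kappa>(1) unfolding s by (auto simp: g'_def algebra_simps)
  next
    fix i r assume "i \<in> insert i0 I" "r \<in> B i"
    then show "f i r \<le> f i z + (\<kappa>(i0 := k0)) i * (r - z)"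
      using \<kappa>(2) k0(2) insert.hyps by (cases "i = i0") auto
  qed
qed

section \<open>Concave kernels\<close>

lemma strictly_concave_onD:
  assumes "strictly_concave_on S f" "x \<in> S" "y \<in> S" "x \<noteq> y" "0 < u" "u < 1"
  shows "(1 - u) * f x + u * f y < f ((1 - u) * x + u * y)"
  using assms unfolding strictly_concave_on_def by blast

text \<open>Equality at \<open>r\<close> would contradict strict concavity at the midpoint of
  \<open>s\<close> and \<open>r\<close>. The weak bound is assumed only at that midpoint, so
  \<open>r\<close> may lie on the boundary of the region where tangent bounds are known.\<close>

lemma strictly_concave_supergradient_strict:
  assumes "strictly_concave_on C f" "s \<in> C" "r \<in> C" "r \<noteq> s"
    and "f ((s + r) / 2) \<le> f s + \<kappa> * ((s + r) / 2 - s)"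
  shows "f r < f s + \<kappa> * (r - s)"
proof -
  have "f ((1 - 1/2) * s + (1/2) * r) > (1 - 1/2) * f s + (1/2) * f r"
    using strictly_concave_onD[OF assms(1-3), of "1/2"] assms(4) by auto
  moreover have "(1 - 1/2) * s + (1/2) * r = (s + r) / 2" by simp
  ultimately have "(1 - 1/2) * f s + (1/2) * f r < f ((s + r) / 2)" by metis
  then have "(1 - 1/2) * f s + (1/2) * f r < f s + \<kappa> * ((s + r) / 2 - s)" using assms(5) by linarith
  then show ?thesis by (simp add: field_simps)
qed

text \<open>Where \<open>K t = - \<infinity>\<close>, the value \<open>rk K t = 0\<close> is junk.\<close>
abbreviation rk :: "(real \<Rightarrow> ereal) \<Rightarrow> real \<Rightarrow> real" where
  "rk K \<equiv> (\<lambda>t. real_of_ereal (K t))"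

definition kernel_domain :: "(real \<Rightarrow> ereal) \<Rightarrow> real set" where
  "kernel_domain K = {t\<in>{0..2 * pi}. K t \<noteq> - \<infinity>}"

lemma concave_kernelD:
  assumes "concave_kernel K"
  shows "K (t + 2 * pi) = K t" "K t \<noteq> \<infinity>" "t \<in> {0<..<2 * pi} \<Longrightarrow> K t \<noteq> - \<infinity>"
    "concave_on {0<..<2 * pi} (rk K)" "(K \<longlongrightarrow> K 0) (at_right 0)" "(K \<longlongrightarrow> K 0) (at_left (2 * pi))"
  using assms unfolding concave_kernel_def by blast+

lemma kernel_periodic:
  assumes "concave_kernel K"
  shows "K (t + 2 * pi * of_int m) = K t"
proof -
  have p: "K (t + 2 * pi) = K t" for t by (rule concave_kernelD(1)[OF assms])
  have n: "K (t + 2 * pi * real n) = K t" for t n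
  proof (induction n)
    case (Suc n)
    have "t + 2 * pi * real (Suc n) = (t + 2 * pi * real n) + 2 * pi" by (simp add: algebra_simps)
    then show ?case using Suc p by metis
  qed simp
  show ?thesis
  proof (cases "m \<ge> 0")
    case True
    then show ?thesis using n[of t "nat m"] by simp
  next
    case False
    then have "t = (t + 2 * pi * of_int m) + 2 * pi * real (nat (- m))" by simp
    then show ?thesis using n[of "t + 2 * pi * of_int m" "nat (- m)"] by metis
  qed
qed

lemma kernel_period_end:
  assumes "concave_kernel K"
  shows "K (2 * pi - t) = K (- t)" "K (2 * pi) = K 0"
  using kernel_periodic[OF assms, of "- t" 1] kernel_periodic[OF assms, of 0 1]
  by (simp_all add: add.commute)

lemma kernel_not_PInf: "concave_kernel K \<Longrightarrow> K t \<noteq> \<infinity>"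
  by (rule concave_kernelD(2))

lemma kernel_real:
  assumes "concave_kernel K" "K t \<noteq> - \<infinity>"
  shows "K t = ereal (rk K t)"
  using assms(2) kernel_not_PInf[OF assms(1), of t] by (cases "K t") simp_all

lemma reduce_mod_period:
  obtains m :: int where "t - 2 * pi * of_int m \<in> {0..<2 * pi}"
proof -
  define m where "m = \<lfloor>t / (2 * pi)\<rfloor>"
  have "of_int m \<le> t / (2 * pi)" "t / (2 * pi) < of_int m + 1" unfolding m_def by linarith+
  then have "of_int m * (2 * pi) \<le> t" "t < (of_int m + 1) * (2 * pi)"
    by (simp_all add: pos_le_divide_eq pos_divide_less_eq)
  moreover have "of_int m * (2 * pi) = 2 * pi * of_int m"
      "(of_int m + 1) * (2 * pi) = 2 * pi * of_int m + 2 * pi"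
    by (simp_all add: distrib_right)
  ultimately have "t - 2 * pi * of_int m \<in> {0..<2 * pi}"
    unfolding atLeastLessThan_iff by linarith
  then show ?thesis by (rule that)
qed

text \<open>Concavity gives continuity inside the period. At 0 the left limit is the limit at
  \<open>2 * pi\<close> transported by periodicity. Continuity is meant in the extended reals, so
  the value minus infinity is allowed.\<close>

lemma isCont_kernel:
  assumes K: "concave_kernel K"
  shows "isCont K t"
proof -
  have inner: "isCont K t" if "t \<in> {0<..<2 * pi}" for t
  proof -
    have "continuous_on {0<..<2 * pi} (\<lambda>t. - rk K t)"
      using concave_kernelD(4)[OF K] unfolding concave_on_def by (rule convex_on_continuous[rotated]) simp
    then have "continuous_on {0<..<2 * pi} (\<lambda>t. - (- rk K t))" by (rule continuous_on_minus)
    then have "continuous_on {0<..<2 * pi} (\<lambda>t. ereal (rk K t))" by (intro continuous_on_ereal) simp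
    moreover have "ereal (rk K t) = K t" if "t \<in> {0<..<2 * pi}" for t
      using kernel_real[OF K concave_kernelD(3)[OF K that]] by (rule sym)
    ultimately have "continuous_on {0<..<2 * pi} K" by (metis (no_types, lifting) continuous_on_cong)
    then show ?thesis using that by (simp add: continuous_on_eq_continuous_at)
  qed
  have zero: "isCont K 0"
  proof -
    have "filterlim (\<lambda>t. t + 2 * pi) (at_left (2 * pi)) (at_left 0)"
      unfolding filterlim_at by (auto intro!: tendsto_eq_intros simp: eventually_at_filter)
    then have "((\<lambda>t. K (t + 2 * pi)) \<longlongrightarrow> K 0) (at_left 0)"
      using concave_kernelD(6)[OF K] filterlim_compose by blast
    then have "(K \<longlongrightarrow> K 0) (at_left 0)" unfolding concave_kernelD(1)[OF K] .
    then have "(K \<longlongrightarrow> K 0) (at 0)"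
      using concave_kernelD(5)[OF K] by (simp add: filterlim_at_split)
    then show ?thesis by (simp add: isCont_def)
  qed
  obtain m :: int where m: "t - 2 * pi * of_int m \<in> {0..<2 * pi}" using reduce_mod_period by blast
  then have "isCont K (t - 2 * pi * of_int m)"
    using inner zero by (cases "t - 2 * pi * of_int m = 0") auto
  then have "isCont (\<lambda>t. K (t - 2 * pi * of_int m)) t" 
    by (rule isCont_o2[where f = "\<lambda>t. t - 2 * pi * of_int m" and g = K, rotated]) simp
  moreover have "(\<lambda>t. K (t - 2 * pi * of_int m)) = K"
  proof
    show "K (t - 2 * pi * of_int m) = K t" for t
    proof -
      have "t - 2 * pi * of_int m = t + 2 * pi * of_int (- m)" by simp
      then show ?thesis using kernel_periodic[OF K, of t "- m"] by (simp only:)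
    qed
  qed
  ultimately show ?thesis by (simp only:)
qed

lemma isCont_rk:
  assumes K: "concave_kernel K" and t: "K t \<noteq> - \<infinity>"
  shows "isCont (rk K) t"
proof -
  have "(K \<longlongrightarrow> ereal (rk K t)) (at t)"
    using isCont_kernel[OF K, of t] unfolding isCont_def kernel_real[OF K t, symmetric] .
  then show ?thesis unfolding isCont_def by (rule lim_real_of_ereal)
qed

lemma kernel_open_domain: "concave_kernel K \<Longrightarrow> {0<..<2 * pi} \<subseteq> kernel_domain K"
  using concave_kernelD(3) by (fastforce simp: kernel_domain_def)

lemma kernel_domain_cases:
  assumes "concave_kernel K"
  shows "K 0 = - \<infinity> \<Longrightarrow> kernel_domain K = {0<..<2 * pi}"
    and "K 0 \<noteq> - \<infinity> \<Longrightarrow> kernel_domain K = {0..2 * pi}"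
proof -
  have ends: "K (2 * pi) = K 0" using assms by (rule kernel_period_end)
  have *: "t = 0 \<or> t = 2 * pi \<or> t \<in> {0<..<2 * pi}" if "t \<in> {0..2 * pi}" for t using that by force
  have inner: "K t \<noteq> - \<infinity>" if "t \<in> {0<..<2 * pi}" for t using concave_kernelD(3)[OF assms that] .
  show "kernel_domain K = {0<..<2 * pi}" if "K 0 = - \<infinity>"
  proof (rule set_eqI)
    show "t \<in> kernel_domain K \<longleftrightarrow> t \<in> {0<..<2 * pi}" for t
      using that ends *[of t] inner[of t] by (auto simp: kernel_domain_def)
  qed
  show "kernel_domain K = {0..2 * pi}" if "K 0 \<noteq> - \<infinity>"
  proof (rule set_eqI)
    show "t \<in> kernel_domain K \<longleftrightarrow> t \<in> {0..2 * pi}" for t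
      using that ends *[of t] inner[of t] by (auto simp: kernel_domain_def)
  qed
qed

lemma concave_on_kernel_domain:
  assumes K: "concave_kernel K"
  shows "concave_on (kernel_domain K) (rk K)"
proof (cases "K 0 = - \<infinity>")
  case True
  then show ?thesis using concave_kernelD(4)[OF K] by (simp add: kernel_domain_cases(1)[OF K])
next
  case False
  have dom: "kernel_domain K = {0..2 * pi}" using False K kernel_domain_cases by blast
  have cont: "isCont (rk K) t" if "t \<in> {0..2 * pi}" for t
  proof (rule isCont_rk[OF K])
    have "t \<in> kernel_domain K" using that dom by simp
    then show "K t \<noteq> - \<infinity>" by (simp add: kernel_domain_def)
  qed
  have conc: "concave_on {0<..<2 * pi} (rk K)" by (rule concave_kernelD(4)[OF K])
  show ?thesis unfolding dom
  proof (rule concave_on_realI)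
    fix x y v :: real
    assume xy: "x \<in> {0..2 * pi}" "y \<in> {0..2 * pi}" and v: "0 \<le> v" "v \<le> 1"
    define u where "u = 1 - v"
    \<comment> \<open>The map \<open>c e\<close> contracts towards \<open>pi\<close>. It moves end
      points inside, is affine and so respects convex combinations, and tends to the identity as
      \<open>e\<close> tends to 0.\<close>
    define c where "c e a = a + e * (pi - a)" for e a :: real
    have c_in: "c e a \<in> {0<..<2 * pi}" if "a \<in> {0..2 * pi}" "0 < e" "e < 1" for e a
    proof -
      have "c e a = (1 - e) * a + e * pi" by (simp add: c_def algebra_simps)
      moreover have "(1 - e) * a \<ge> 0" "(1 - e) * a \<le> (1 - e) * (2 * pi)"
        using that by (auto intro!: mult_left_mono)
      moreover have "e * pi > 0" "(1 - e) * (2 * pi) + e * pi < 2 * pi" using that by (auto simp: algebra_simps)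
      ultimately show ?thesis by auto
    qed
    have lim: "((\<lambda>e. rk K (c e a)) \<longlongrightarrow> rk K a) (at_right 0)" if "a \<in> {0..2 * pi}" for a
      by (rule isCont_tendsto_compose[OF cont[OF that]]) (auto simp: c_def intro!: tendsto_eq_intros)
    have in3: "u * x + v * y \<in> {0..2 * pi}"
      using xy v convexD[of "{0..2*pi}" x y u v] by (auto simp: convex_real_interval u_def)
    have "\<forall>\<^sub>F e in at_right 0. u * rk K (c e x) + v * rk K (c e y) \<le> rk K (c e (u * x + v * y))"
    proof -
      have "\<forall>\<^sub>F e in at_right (0::real). 0 < e \<and> e < 1" by (auto simp: eventually_at_right_field intro!: exI[of _ 1])
      then show ?thesis
      proof eventually_elim
        case (elim e)
        have "(1 - v) * c e x + v * c e y = c e (u * x + v * y)" by (simp add: c_def u_def algebra_simps)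
        then show ?case
          using concave_onD[OF conc v c_in[OF xy(1)] c_in[OF xy(2)], of e e] elim by (simp add: u_def)
      qed
    qed
    then have "u * rk K x + v * rk K y \<le> rk K (u * x + v * y)"
      using lim[OF in3] lim[OF xy(1)] lim[OF xy(2)]
      by (intro tendsto_le[OF _ _ tendsto_add[OF tendsto_mult[OF tendsto_const] tendsto_mult[OF tendsto_const]]]) auto
    then show "(1 - v) * rk K x + v * rk K y \<le> rk K ((1 - v) * x + v * y)" by (simp add: u_def)
  qed (simp add: convex_real_interval)
qed

lemma strictly_concave_kernelD: "strictly_concave_kernel K \<Longrightarrow> concave_kernel K"
  by (simp add: strictly_concave_kernel_def)

text \<open>Strictness passes to the end points because the midpoint of two points of the closed
  interval is interior.\<close>
lemma strictly_concave_on_kernel_domain: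
  assumes K: "strictly_concave_kernel K"
  shows "strictly_concave_on (kernel_domain K) (rk K)"
  unfolding strictly_concave_on_def
proof (intro conjI ballI allI impI)
  have K': "concave_kernel K" using K by (rule strictly_concave_kernelD)
  note conc = concave_on_kernel_domain[OF K']
  show conv: "convex (kernel_domain K)" using conc by (rule concave_on_imp_convex)
  fix x y u :: real
  assume xy: "x \<in> kernel_domain K" "y \<in> kernel_domain K" "x \<noteq> y" and u: "0 < u \<and> u < 1"
  define p where "p = (1 - u) * x + u * y"
  have p: "p \<in> kernel_domain K" unfolding p_def using conv xy u using convexD[of "kernel_domain K" x y "1 - u" u] by auto
  have mid: "rk K ((a + p) / 2) \<ge> (rk K a + rk K p) / 2" if "a \<in> kernel_domain K" for a
    using concave_onD[OF conc, of "1/2" a p] that p by (simp add: add_divide_distrib)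
  have pin: "p \<in> {0<..<2 * pi}"
  proof -
    have b: "0 \<le> x" "x \<le> 2 * pi" "0 \<le> y" "y \<le> 2 * pi" using xy by (auto simp: kernel_domain_def)
    consider "x < y" | "y < x" using xy(3) by force
    then show ?thesis
    proof cases
      case 1
      then have "u * (y - x) > 0" "(1 - u) * (y - x) > 0" using u by auto
      then have "x < p" "p < y" by (auto simp: p_def algebra_simps)
      then show ?thesis using b by auto
    next
      case 2
      then have "u * (x - y) > 0" "(1 - u) * (x - y) > 0" using u by auto
      then have "y < p" "p < x" by (auto simp: p_def algebra_simps)
      then show ?thesis using b by auto
    qed
  qed
  have inn: "(x + p) / 2 \<in> {0<..<2 * pi}" "(y + p) / 2 \<in> {0<..<2 * pi}"
    using pin xy by (auto simp: kernel_domain_def)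
  have "(1 - u) * ((x + p) / 2) + u * ((y + p) / 2) = (((1 - u) * x + u * y) + p) / 2"
    by (simp add: field_simps)
  then have comb: "(1 - u) * ((x + p) / 2) + u * ((y + p) / 2) = p" by (simp flip: p_def)
  have "rk K ((1 - u) * ((x + p) / 2) + u * ((y + p) / 2))
      > (1 - u) * rk K ((x + p) / 2) + u * rk K ((y + p) / 2)"
    using K u xy(3) unfolding strictly_concave_kernel_def
    by (intro strictly_concave_onD[OF _ inn]) auto
  then have "rk K p > (1 - u) * rk K ((x + p) / 2) + u * rk K ((y + p) / 2)" unfolding comb .
  moreover have "(1 - u) * rk K ((x + p) / 2) \<ge> (1 - u) * ((rk K x + rk K p) / 2)"
    "u * rk K ((y + p) / 2) \<ge> u * ((rk K y + rk K p) / 2)"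
    using mid xy u by (auto intro!: mult_left_mono)
  \<comment> \<open>The value at \<open>p\<close> occurs on the right with factor one half;
    absorbing it on the left leaves the desired strict inequality.\<close>
  ultimately have "rk K p > ((1 - u) * rk K x + u * rk K y + rk K p) / 2"
    by (simp add: field_simps)
  then show "rk K ((1 - u) * x + u * y) > (1 - u) * rk K x + u * rk K y"
    unfolding p_def[symmetric] by simp
qed

text \<open>The tangent bound is known only on the open period, but the midpoint of \<open>s\<close>
  and \<open>r\<close> lies there even if \<open>r\<close> is an end point. A value minus infinity
  at \<open>r\<close> is harmless.\<close>

lemma kernel_tangent_strict:
  assumes K: "strictly_concave_kernel K" and s: "s \<in> kernel_domain K"
    and sup: "\<And>r. r \<in> {0<..<2 * pi} \<Longrightarrow> rk K r \<le> rk K s + \<kappa> * (r - s)"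
    and r: "r \<in> {0..2 * pi}" "r \<noteq> s"
  shows "K r < ereal (rk K s + \<kappa> * (r - s))"
proof (cases "K r = - \<infinity>")
  case False
  then have rd: "r \<in> kernel_domain K" using r by (simp add: kernel_domain_def)
  have "(s + r) / 2 \<in> {0<..<2 * pi}" using s r by (auto simp: kernel_domain_def)
  then have "rk K r < rk K s + \<kappa> * (r - s)"
    using strictly_concave_supergradient_strict[OF strictly_concave_on_kernel_domain[OF K] s rd r(2)] sup by blast
  then show ?thesis by (subst kernel_real[OF strictly_concave_kernelD[OF K] False]) simp
qed simp

section \<open>Sums of translates\<close>

lemma sum_eq_MInf:
  fixes f :: "'a \<Rightarrow> ereal"
  assumes "finite A" "\<And>i. i \<in> A \<Longrightarrow> f i \<noteq> \<infinity>" "i \<in> A" "f i = - \<infinity>"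
  shows "sum f A = - \<infinity>"
proof -
  have "sum f (A - {i}) \<noteq> \<infinity>" using assms by (auto simp: sum_Pinfty)
  then show ?thesis using assms by (simp add: sum.remove)
qed

lemma Ffun_real:
  assumes L: "concave_kernel L" and K: "concave_kernel K"
    and fin: "L t \<noteq> - \<infinity>" "\<And>j. j < length y \<Longrightarrow> K (t - y ! j) \<noteq> - \<infinity>"
  shows "Ffun L K y t = ereal (rk L t + (\<Sum>j<length y. rk K (t - y ! j)))"
proof -
  have "(\<Sum>j<length y. K (t - y ! j)) = (\<Sum>j<length y. ereal (rk K (t - y ! j)))"
    using kernel_real[OF K fin(2)] by (intro sum.cong) auto
  moreover have "L t = ereal (rk L t)" by (rule kernel_real[OF L fin(1)])
  ultimately show ?thesis unfolding Ffun_def by (metis plus_ereal.simps(1) sum_ereal)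
qed

lemma Ffun_eq_MInf:
  assumes L: "concave_kernel L" and K: "concave_kernel K"
    and inf: "L t = - \<infinity> \<or> (\<exists>j<length y. K (t - y ! j) = - \<infinity>)"
  shows "Ffun L K y t = - \<infinity>"
proof -
  have s: "(\<Sum>j<length y. K (t - y ! j)) \<noteq> \<infinity>"
    using kernel_not_PInf[OF K] by (auto simp: sum_Pinfty)
  show ?thesis
  proof (cases "L t = - \<infinity>")
    case True
    then show ?thesis using s by (simp add: Ffun_def)
  next
    case False
    then obtain j where "j < length y" "K (t - y ! j) = - \<infinity>" using inf by auto
    then have "(\<Sum>j<length y. K (t - y ! j)) = - \<infinity>"
      using kernel_not_PInf[OF K] by (intro sum_eq_MInf[of _ _ j]) auto
    then show ?thesis using kernel_not_PInf[OF L, of t] by (simp add: Ffun_def)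
  qed
qed

text \<open>Addition of extended reals is discontinuous only where opposite infinities meet; no
  limit here is plus infinity.\<close>

lemma tendsto_sum_ereal_not_PInf:
  fixes f :: "'i \<Rightarrow> 'a \<Rightarrow> ereal"
  assumes "finite I" "\<And>i. i \<in> I \<Longrightarrow> (f i \<longlongrightarrow> l i) F" "\<And>i. i \<in> I \<Longrightarrow> l i \<noteq> \<infinity>"
  shows "((\<lambda>x. \<Sum>i\<in>I. f i x) \<longlongrightarrow> (\<Sum>i\<in>I. l i)) F"
  using assms
proof (induction I rule: finite_induct)
  case (insert i I)
  then have "(\<Sum>i\<in>I. l i) \<noteq> \<infinity>" by (auto simp: sum_Pinfty)
  then show ?case using insert by (auto intro!: tendsto_add_ereal_general)
qed simp

text \<open>Joint continuity in the nodes and in \<open>t\<close>, the basis of both compactness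
  arguments below. The nodes are not confined to one period.\<close>

lemma tendsto_Ffun:
  assumes L: "concave_kernel L" and K: "concave_kernel K"
    and T: "(T \<longlongrightarrow> t) F" and Y: "\<And>j. j < length y \<Longrightarrow> ((\<lambda>x. Y x ! j) \<longlongrightarrow> y ! j) F"
    and len: "\<And>x. length (Y x) = length y"
  shows "((\<lambda>x. Ffun L K (Y x) (T x)) \<longlongrightarrow> Ffun L K y t) F"
proof -
  have "((\<lambda>x. L (T x)) \<longlongrightarrow> L t) F" by (rule isCont_tendsto_compose[OF isCont_kernel[OF L] T])
  moreover have "((\<lambda>x. \<Sum>j<length y. K (T x - Y x ! j)) \<longlongrightarrow> (\<Sum>j<length y. K (t - y ! j))) F"
  proof (rule tendsto_sum_ereal_not_PInf)
    fix j assume "j \<in> {..<length y}"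
    then show "((\<lambda>x. K (T x - Y x ! j)) \<longlongrightarrow> K (t - y ! j)) F"
      using T Y by (intro isCont_tendsto_compose[OF isCont_kernel[OF K]] tendsto_diff) auto
  qed (auto simp: kernel_not_PInf[OF K])
  moreover have "(\<Sum>j<length y. K (t - y ! j)) \<noteq> \<infinity>"
    using kernel_not_PInf[OF K] by (auto simp: sum_Pinfty)
  ultimately show ?thesis
    unfolding Ffun_def len using kernel_not_PInf[OF L, of t] by (intro tendsto_add_ereal_general) auto
qed

lemma continuous_on_Ffun:
  assumes L: "concave_kernel L" and K: "concave_kernel K"
  shows "continuous_on S (Ffun L K y)"
  unfolding continuous_on_def
  using tendsto_Ffun[OF L K tendsto_ident_at, of y "\<lambda>_. y"] by auto

lemma Ffun_periodic:
  assumes L: "concave_kernel L" and K: "concave_kernel K"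
  shows "Ffun L K y (t + 2 * pi * of_int m) = Ffun L K y t"
proof -
  have "K (t + 2 * pi * of_int m - x) = K (t - x)" for x
  proof -
    have "t + 2 * pi * of_int m - x = (t - x) + 2 * pi * of_int m" by simp
    then show ?thesis using kernel_periodic[OF K, of "t - x" m] by (simp only:)
  qed
  then show ?thesis unfolding Ffun_def kernel_periodic[OF L] by (simp only:)
qed

lemma Ffun_mset:
  assumes "mset x = mset y"
  shows "Ffun L K x t = Ffun L K y t"
proof -
  have "(\<Sum>j<length x. K (t - x ! j)) = sum_mset (image_mset (\<lambda>a. K (t - a)) (mset x))" for x
  proof -
    have "(\<Sum>j<length x. K (t - x ! j)) = sum_list (map (\<lambda>a. K (t - a)) x)"
      by (simp add: sum_list_sum_nth atLeast0LessThan)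
    also have "\<dots> = sum_mset (mset (map (\<lambda>a. K (t - a)) x))" by (simp only: sum_mset_sum_list)
    finally show ?thesis by (simp only: mset_map)
  qed
  then show ?thesis unfolding Ffun_def by (simp add: assms)
qed

text \<open>Limits and perturbations of configurations can leave the half-open box that models the
  torus; reducing each coordinate modulo the period leaves \<open>F\<close> unchanged.\<close>

lemma Ffun_torus_representative:
  assumes K: "concave_kernel K"
  obtains y' where "y' \<in> torus_pts (length y)" "\<And>t. Ffun L K y' t = Ffun L K y t"
proof -
  have "\<forall>a. \<exists>m::int. a - 2 * pi * of_int m \<in> {0..<2 * pi}" using reduce_mod_period by meson
  then obtain m :: "real \<Rightarrow> int" where m: "\<And>a. a - 2 * pi * of_int (m a) \<in> {0..<2 * pi}" by metis
  define y' where "y' = map (\<lambda>a. a - 2 * pi * of_int (m a)) y"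
  have "y' \<in> torus_pts (length y)" unfolding torus_pts_def y'_def using m by auto
  moreover have "Ffun L K y' t = Ffun L K y t" for t
  proof -
    have "K (t - y' ! j) = K (t - y ! j)" if "j < length y" for j
    proof -
      have "t - y' ! j = (t - y ! j) + 2 * pi * of_int (m (y ! j))" using that by (simp add: y'_def)
      then show ?thesis using kernel_periodic[OF K] by (simp only:)
    qed
    then show ?thesis unfolding Ffun_def by (auto simp: y'_def)
  qed
  ultimately show ?thesis by (rule that)
qed

text \<open>Inside the period, minus infinity can occur only at the finitely many nodes. Hence
  maximal values of \<open>F\<close> are real numbers.\<close>

lemma Ffun_finite_somewhere:
  assumes L: "concave_kernel L" and K: "concave_kernel K"
  shows "\<exists>t\<in>{0..2 * pi}. Ffun L K y t \<noteq> - \<infinity>"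
proof -
  obtain y' where y': "y' \<in> torus_pts (length y)" "\<And>t. Ffun L K y' t = Ffun L K y t"
    using Ffun_torus_representative[OF K] by blast
  have "infinite ({0<..<2 * pi} - set y')" by (simp add: infinite_Ioo)
  then obtain t where t: "t \<in> {0<..<2 * pi}" "t \<notin> set y'" by (metis Diff_iff finite.emptyI ex_in_conv)
  have "K (t - y' ! j) \<noteq> - \<infinity>" if "j < length y'" for j
  proof -
    have "y' ! j \<in> set y'" using that by simp
    then have b: "0 \<le> y' ! j" "y' ! j < 2 * pi" "y' ! j \<noteq> t" using y'(1) t(2) by (auto simp: torus_pts_def)
    consider "t - y' ! j \<in> {0<..<2 * pi}" | "t - y' ! j + 2 * pi \<in> {0<..<2 * pi}" using b t(1) by force
    then show ?thesis using concave_kernelD(3)[OF K] concave_kernelD(1)[OF K] by cases metis+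
  qed
  then have "Ffun L K y' t = ereal (rk L t + (\<Sum>j<length y'. rk K (t - y' ! j)))"
    using concave_kernelD(3)[OF L t(1)] by (intro Ffun_real L K) auto
  then have "Ffun L K y' t \<noteq> - \<infinity>" by simp
  then show ?thesis using t(1) y'(2) by (intro bexI[of _ t]) auto
qed

lemma Ffun_attains_sup_on:
  assumes "concave_kernel L" "concave_kernel K" "a \<le> b"
  obtains t where "t \<in> {a..b}" "\<And>s. s \<in> {a..b} \<Longrightarrow> Ffun L K y s \<le> Ffun L K y t"
  using continuous_attains_sup[OF _ _ continuous_on_Ffun[OF assms(1,2)], of "{a..b}" y] assms(3) by auto

lemma Ffun_attains_sup:
  assumes L: "concave_kernel L" and K: "concave_kernel K"
  obtains t where "t \<in> {0..2 * pi}" "\<And>s. Ffun L K y s \<le> Ffun L K y t"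
proof -
  obtain t where t: "t \<in> {0..2 * pi}" "\<And>s. s \<in> {0..2 * pi} \<Longrightarrow> Ffun L K y s \<le> Ffun L K y t"
    using Ffun_attains_sup_on[OF L K, of 0 "2 * pi"] by auto
  have "Ffun L K y s \<le> Ffun L K y t" for s
  proof -
    obtain m :: int where m: "s - 2 * pi * of_int m \<in> {0..<2 * pi}" using reduce_mod_period by blast
    then have "Ffun L K y (s - 2 * pi * of_int m) \<le> Ffun L K y t" by (intro t(2)) auto
    moreover have "s = (s - 2 * pi * of_int m) + 2 * pi * of_int m" by simp
    ultimately show ?thesis using Ffun_periodic[OF L K] by metis
  qed
  then show ?thesis using t(1) that by blast
qed

lemma Ffun_real_at_max:
  assumes L: "concave_kernel L" and K: "concave_kernel K"
    and max: "\<And>s. s \<in> {0..2 * pi} \<Longrightarrow> Ffun L K y s \<le> Ffun L K y t"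
  shows "L t \<noteq> - \<infinity>" "\<And>j. j < length y \<Longrightarrow> K (t - y ! j) \<noteq> - \<infinity>"
    "Ffun L K y t = ereal (rk L t + (\<Sum>j<length y. rk K (t - y ! j)))"
proof -
  have "Ffun L K y t \<noteq> - \<infinity>"
    using Ffun_finite_somewhere[OF L K, of y] max by (metis ereal_infty_less_eq(2))
  then show 1: "L t \<noteq> - \<infinity>" and 2: "\<And>j. j < length y \<Longrightarrow> K (t - y ! j) \<noteq> - \<infinity>"
    using Ffun_eq_MInf[OF L K] by blast+
  show "Ffun L K y t = ereal (rk L t + (\<Sum>j<length y. rk K (t - y ! j)))"
    by (rule Ffun_real[OF L K 1 2])
qed

section \<open>Existence of a minimizer by compactness\<close>

lemma bounded_family_convergent_subsequence:
  fixes X :: "nat \<Rightarrow> nat \<Rightarrow> real"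
  assumes "\<And>m i. i < n \<Longrightarrow> X m i \<in> {a..b}"
  shows "\<exists>r x. strict_mono r \<and> (\<forall>i<n. (\<lambda>m. X (r m) i) \<longlonglongrightarrow> x i)"
  using assms
proof (induction n)
  case 0
  then show ?case by (intro exI[of _ "\<lambda>m. m"]) (simp add: strict_mono_def)
next
  case (Suc n)
  then obtain r x where r: "strict_mono r" "\<And>i. i < n \<Longrightarrow> (\<lambda>m. X (r m) i) \<longlonglongrightarrow> x i" by force
  have "\<forall>m. X (r m) n \<in> {a..b}" using Suc.prems by auto
  then obtain l q where q: "strict_mono q" "((\<lambda>m. X (r m) n) \<circ> q) \<longlonglongrightarrow> l"
    using compact_imp_seq_compact[OF compact_Icc, of a b] unfolding seq_compact_def by metis
  show ?case
  proof (intro exI[of _ "r \<circ> q"] exI[of _ "x(n := l)"] conjI allI impI)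
    show "strict_mono (r \<circ> q)" using r(1) q(1) by (rule strict_mono_o)
    fix i assume "i < Suc n"
    then show "(\<lambda>m. X ((r \<circ> q) m) i) \<longlonglongrightarrow> (x(n := l)) i"
      using q(2) LIMSEQ_subseq_LIMSEQ[OF r(2) q(1), of i] by (cases "i = n") (auto simp: o_def)
  qed
qed

text \<open>A minimizing sequence has a subsequence converging in the closed box. For each fixed
  \<open>t\<close> the value of \<open>F\<close> passes to the limit, so every value at the limit
  configuration is at most the infimum; the limit is then reduced to the torus.\<close>

lemma M_val_attained:
  assumes L: "concave_kernel L" and K: "concave_kernel K"
  obtains w where "w \<in> torus_pts n" "M_val L K n = (SUP t. Ffun L K w t)"
proof -
  define G where "G y = (SUP t. Ffun L K y t)" for y
  have M: "M_val L K n = (INF y\<in>torus_pts n. G y)" by (simp add: M_val_def G_def)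
  have "replicate n 0 \<in> torus_pts n" by (auto simp: torus_pts_def)
  then have ne: "torus_pts n \<noteq> {}" by auto
  obtain g where g: "range g \<subseteq> G ` torus_pts n" "g \<longlonglongrightarrow> M_val L K n"
    using Inf_as_limit[of "G ` torus_pts n"] ne unfolding M by auto
  then have "\<forall>m. \<exists>y. y \<in> torus_pts n \<and> g m = G y" by blast
  then obtain Y where Y: "\<And>m. Y m \<in> torus_pts n" "\<And>m. g m = G (Y m)" by metis
  have len: "length (Y m) = n" for m using Y(1) by (auto simp: torus_pts_def)
  have bd: "Y m ! i \<in> {0..2 * pi}" if "i < n" for m i
  proof -
    have "Y m ! i \<in> set (Y m)" using that len by simp
    then show ?thesis using Y(1)[of m] by (auto simp: torus_pts_def)
  qed
  obtain r x where r: "strict_mono r" "\<And>i. i < n \<Longrightarrow> (\<lambda>m. Y (r m) ! i) \<longlonglongrightarrow> x i"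
    using bounded_family_convergent_subsequence[of n "\<lambda>m i. Y m ! i", OF bd] by blast
  define y where "y = map x [0..<n]"
  have "G y \<le> M_val L K n"
    unfolding G_def
  proof (rule SUP_least)
    fix t
    have "(\<lambda>m. Ffun L K (Y (r m)) t) \<longlonglongrightarrow> Ffun L K y t"
      by (rule tendsto_Ffun[OF L K tendsto_const]) (auto simp: y_def len r(2))
    moreover have "(\<lambda>m. g (r m)) \<longlonglongrightarrow> M_val L K n"
      using LIMSEQ_subseq_LIMSEQ[OF g(2) r(1)] by (simp add: o_def)
    moreover have "Ffun L K (Y (r m)) t \<le> g (r m)" for m
      unfolding Y(2) G_def by (rule SUP_upper) simp
    ultimately show "Ffun L K y t \<le> M_val L K n" by (meson LIMSEQ_le)
  qed
  moreover obtain w where w: "w \<in> torus_pts (length y)" "\<And>t. Ffun L K w t = Ffun L K y t"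
    using Ffun_torus_representative[OF K] by blast
  ultimately have "w \<in> torus_pts n" "G w \<le> M_val L K n" by (auto simp: y_def G_def)
  moreover have "M_val L K n \<le> G w" unfolding M using calculation(1) by (rule INF_lower)
  ultimately show ?thesis using that by (simp add: G_def)
qed

section \<open>Nodes are not maximum points\<close>

text \<open>\<open>right_deriv\<close> is a bare \<open>Lim\<close>, so convergence has to be shown
  first: the quotients increase as \<open>h\<close> decreases to 0 and are bounded by the chord
  slope from \<open>l\<close>. The derivative is their supremum, hence above the chord slope to
  \<open>r\<close>.\<close>

lemma concave_slope_le_right_deriv:
  fixes f :: "real \<Rightarrow> real"
  assumes c: "concave_on A f" and A: "l \<in> A" "r \<in> A" and lt: "l < t" "t < r"
  shows "(f r - f t) / (r - t) \<le> right_deriv f t"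
proof -
  have iv: "x \<in> A" if "l \<le> x" "x \<le> r" for x
    using concave_on_imp_convex[OF c] A that by (metis is_interval_convex_1 mem_is_interval_1_I)
  define \<phi> where "\<phi> h = (f (t + h) - f t) / h" for h
  have anti: "\<phi> h' \<le> \<phi> h" if "0 < h" "h \<le> h'" "h' \<le> r - t" for h h'
    using concave_on_slope_antimono[OF c iv[of t] iv[of "t + h"] iv[of "t + h'"]] that lt
    by (simp add: \<phi>_def)
  have bound: "\<phi> h \<le> (f l - f t) / (l - t)" if "0 < h" "h \<le> r - t" for h
    using concave_on_slope_antimono[OF c iv[of t] iv[of l] iv[of "t + h"]] that lt
    by (simp add: \<phi>_def)
  define S where "S = Sup (\<phi> ` {0<..r - t})"
  have bdd: "bdd_above (\<phi> ` {0<..r - t})" using bound by (intro bdd_aboveI2[where M = "(f l - f t) / (l - t)"]) auto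
  have ne: "\<phi> ` {0<..r - t} \<noteq> {}" using lt by auto
  have upper: "\<phi> h \<le> S" if "0 < h" "h \<le> r - t" for h
    unfolding S_def using that bdd by (intro cSup_upper) auto
  have "(\<phi> \<longlongrightarrow> S) (at_right 0)"
  proof (rule order_tendstoI)
    fix a assume "a < S"
    then obtain h0 where h0: "0 < h0" "h0 \<le> r - t" "a < \<phi> h0"
      unfolding S_def less_cSup_iff[OF ne bdd] by auto
    have "a < \<phi> h" if "0 < h" "h < h0" for h using anti[of h h0] that h0 by auto
    then show "\<forall>\<^sub>F h in at_right 0. a < \<phi> h"
      using h0(1) by (auto simp: eventually_at_right_field)
  next
    fix a assume "S < a"
    then have "\<phi> h < a" if "0 < h" "h < r - t" for h using upper[of h] that by auto
    then show "\<forall>\<^sub>F h in at_right 0. \<phi> h < a"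
      using lt by (auto simp: eventually_at_right_field intro!: exI[of _ "r - t"])
  qed
  then have "right_deriv f t = S"
    unfolding right_deriv_def \<phi>_def by (intro tendsto_Lim) simp_all
  then show ?thesis using upper[of "r - t"] lt by (simp add: \<phi>_def)
qed

text \<open>The mirror image: quotients from the left decrease to their infimum, which is finite
  thanks to the chord to \<open>r\<close>.\<close>

lemma left_deriv_le_concave_slope:
  fixes f :: "real \<Rightarrow> real"
  assumes c: "concave_on A f" and A: "l \<in> A" "r \<in> A" and lt: "l < t" "t < r"
  shows "left_deriv f t \<le> (f t - f l) / (t - l)"
proof -
  have iv: "x \<in> A" if "l \<le> x" "x \<le> r" for x
    using concave_on_imp_convex[OF c] A that by (metis is_interval_convex_1 mem_is_interval_1_I)
  define \<phi> where "\<phi> h = (f (t + h) - f t) / h" for h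
  have anti: "\<phi> h' \<le> \<phi> h" if "h' < 0" "h \<le> h'" "l - t \<le> h" for h h'
    using concave_on_slope_antimono[OF c iv[of t] iv[of "t + h"] iv[of "t + h'"]] that lt
    by (simp add: \<phi>_def)
  have bound: "(f r - f t) / (r - t) \<le> \<phi> h" if "h < 0" "l - t \<le> h" for h
    using concave_on_slope_antimono[OF c iv[of t] iv[of "t + h"] iv[of r]] that lt
    by (simp add: \<phi>_def)
  define S where "S = Inf (\<phi> ` {l - t..<0})"
  have bdd: "bdd_below (\<phi> ` {l - t..<0})" using bound by (intro bdd_belowI2[where m = "(f r - f t) / (r - t)"]) auto
  have ne: "\<phi> ` {l - t..<0} \<noteq> {}" using lt by auto
  have lower: "S \<le> \<phi> h" if "h < 0" "l - t \<le> h" for h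
    unfolding S_def using that bdd by (intro cInf_lower) auto
  have "(\<phi> \<longlongrightarrow> S) (at_left 0)"
  proof (rule order_tendstoI)
    fix a assume "S < a"
    then obtain h0 where h0: "h0 < 0" "l - t \<le> h0" "\<phi> h0 < a"
      unfolding S_def cInf_less_iff[OF ne bdd] by auto
    have "\<phi> h < a" if "h < 0" "h0 < h" for h using anti[of h h0] that h0 by auto
    then show "\<forall>\<^sub>F h in at_left 0. \<phi> h < a"
      using h0(1) by (auto simp: eventually_at_left_field)
  next
    fix a assume "a < S"
    then have "a < \<phi> h" if "h < 0" "l - t < h" for h using lower[of h] that by auto
    then show "\<forall>\<^sub>F h in at_left 0. a < \<phi> h"
      using lt by (auto simp: eventually_at_left_field intro!: exI[of _ "l - t"])
  qed
  then have "left_deriv f t = S"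
    unfolding left_deriv_def \<phi>_def by (intro tendsto_Lim) simp_all
  moreover have "\<phi> (l - t) = (f t - f l) / (t - l)"
    unfolding \<phi>_def by (metis add.commute diff_add_cancel minus_diff_eq minus_divide_divide)
  ultimately show ?thesis using lower[of "l - t"] lt by simp
qed

text \<open>By concavity the chord from the steep end is at least as steep as the tangents near that
  end. So from 0 the kernel rises faster than any linear rate in direction \<open>\<sigma>\<close>,
  which is 1 for the end 0 and -1 for the end \<open>2 * pi\<close>, identified with 0.\<close>

lemma cond_infty'_steep_side:
  assumes K: "concave_kernel K" and inf: "cond_infty' K" and fin: "K 0 \<noteq> - \<infinity>"
  obtains \<sigma> :: real where "\<sigma> = 1 \<or> \<sigma> = - 1"
    "\<And>C. \<forall>\<^sub>F h in at_right 0. rk K (\<sigma> * h) - rk K 0 \<ge> C * h"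
proof -
  have dom: "kernel_domain K = {0..2 * pi}" using kernel_domain_cases(2)[OF K fin] .
  have c: "concave_on {0..2 * pi} (rk K)" using concave_on_kernel_domain[OF K] unfolding dom .
  have ends: "K (2 * pi) = K 0" "K (2 * pi - h) = K (- h)" for h
    by (rule kernel_period_end[OF K])+
  have ev: "\<forall>\<^sub>F h in at_right (0::real). 0 < h \<and> h < 2 * pi"
    by (auto simp: eventually_at_right_field intro!: exI[of _ "2 * pi"])
  consider "filterlim (right_deriv (rk K)) at_bot (at_left (2 * pi))"
    | "filterlim (left_deriv (rk K)) at_top (at_right 0)"
    using inf unfolding cond_infty'_def Let_def by blast
  then show ?thesis
  proof cases
    case 1
    have lim: "filterlim (\<lambda>h. 2 * pi - h) (at_left (2 * pi)) (at_right 0)"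
      unfolding filterlim_at by (auto intro!: tendsto_eq_intros simp: eventually_at_filter)
    have "\<forall>\<^sub>F h in at_right 0. rk K (- 1 * h) - rk K 0 \<ge> C * h" for C
    proof -
      have "\<forall>\<^sub>F h in at_right 0. right_deriv (rk K) (2 * pi - h) \<le> - C"
        using filterlim_compose[OF 1 lim] unfolding filterlim_at_bot by blast
      with ev show ?thesis
      proof eventually_elim
        case (elim h)
        then have "(rk K (2 * pi) - rk K (2 * pi - h)) / h \<le> - C"
          using concave_slope_le_right_deriv[OF c, of 0 "2 * pi" "2 * pi - h"] by simp
        then have "rk K (2 * pi) - rk K (2 * pi - h) \<le> - C * h" using elim by (simp add: pos_divide_le_eq)
        then show ?case unfolding ends by simp
      qed
    qed
    then show ?thesis using that[of "- 1"] by blast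
  next
    case 2
    have "\<forall>\<^sub>F h in at_right 0. rk K (1 * h) - rk K 0 \<ge> C * h" for C
    proof -
      have "\<forall>\<^sub>F h in at_right 0. C \<le> left_deriv (rk K) h"
        using 2 unfolding filterlim_at_top by blast
      with ev show ?thesis
      proof eventually_elim
        case (elim h)
        then have "C \<le> (rk K h - rk K 0) / h"
          using left_deriv_le_concave_slope[OF c, of 0 "2 * pi" h] by simp
        then show ?case using elim by (simp add: pos_le_divide_eq)
      qed
    qed
    then show ?thesis using that[of 1] by blast
  qed
qed

text \<open>A concave function stays above its chords, so from a finite value it falls at most
  linearly. The point is reduced modulo the period so that a chord in direction
  \<open>\<sigma>\<close> fits into one period.\<close>

lemma kernel_one_sided_linear_lower_bound:
  assumes Q: "concave_kernel Q" and fin: "Q p \<noteq> - \<infinity>" and \<sigma>: "\<sigma> = 1 \<or> \<sigma> = (- 1 :: real)"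
  shows "\<exists>C. \<forall>\<^sub>F h in at_right 0. Q (p + \<sigma> * h) \<noteq> - \<infinity> \<and> rk Q (p + \<sigma> * h) - rk Q p \<ge> - C * h"
proof -
  note c = concave_on_kernel_domain[OF Q]
  obtain m :: int where m: "p - 2 * pi * of_int m \<in> {0..<2 * pi}" using reduce_mod_period by blast
  have red: "\<exists>C. \<forall>\<^sub>F h in at_right 0. Q (p + \<sigma> * h) \<noteq> - \<infinity> \<and> rk Q (p + \<sigma> * h) - rk Q p \<ge> - C * h"
    if p0: "p = p0 + 2 * pi * of_int k" "p0 \<in> {0..2 * pi}" and r0: "r0 \<in> {0<..<2 * pi}" "\<sigma> * (r0 - p0) > 0"
    for p0 r0 k
  proof -
    have per: "Q (p + s) = Q (p0 + s)" for s
    proof -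
      have "p + s = (p0 + s) + 2 * pi * of_int k" using p0(1) by simp
      then show ?thesis using kernel_periodic[OF Q] by (simp only:)
    qed
    have Qp: "Q p = Q p0" using per[of 0] by simp
    have pd: "p0 \<in> kernel_domain Q" using p0(2) fin Qp by (simp add: kernel_domain_def)
    \<comment> \<open>Slope of the chord from \<open>p0\<close> to the interior point
      \<open>r0\<close> lying in direction \<open>\<sigma>\<close>.\<close>
    define D where "D = (rk Q r0 - rk Q p0) / (r0 - p0)"
    have "Q (p + \<sigma> * h) \<noteq> - \<infinity> \<and> rk Q (p + \<sigma> * h) - rk Q p \<ge> - (- \<sigma> * D) * h"
      if h: "0 < h" "h < \<sigma> * (r0 - p0)" for h
    proof -
      have inn: "p0 + \<sigma> * h \<in> {0<..<2 * pi}" using h \<sigma> p0(2) r0 by auto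
      then have dd: "p0 + \<sigma> * h \<in> kernel_domain Q" "r0 \<in> kernel_domain Q"
        using kernel_open_domain[OF Q] r0 by auto
      have "\<sigma> * D * h \<le> rk Q (p0 + \<sigma> * h) - rk Q p0"
        using \<sigma>
      proof
        assume s: "\<sigma> = 1"
        have "D \<le> (rk Q (p0 + h) - rk Q p0) / (p0 + h - p0)"
          unfolding D_def using h s dd r0 by (intro concave_on_slope_antimono[OF c pd]) auto
        then show ?thesis using h s by (simp add: pos_le_divide_eq)
      next
        assume s: "\<sigma> = - 1"
        have "(rk Q (p0 - h) - rk Q p0) / (p0 - h - p0) \<le> D"
          unfolding D_def using h s dd r0 by (intro concave_on_slope_antimono[OF c pd]) auto
        then have "- D \<le> (rk Q (p0 - h) - rk Q p0) / h" by simp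
        then show ?thesis using h s by (simp add: pos_le_divide_eq)
      qed
      moreover have "Q (p0 + \<sigma> * h) \<noteq> - \<infinity>" by (rule concave_kernelD(3)[OF Q inn])
      ultimately show ?thesis unfolding per Qp by simp
    qed
    then have "\<forall>\<^sub>F h in at_right 0. Q (p + \<sigma> * h) \<noteq> - \<infinity> \<and> rk Q (p + \<sigma> * h) - rk Q p \<ge> - (- \<sigma> * D) * h"
      using r0(2) unfolding eventually_at_right_field by blast
    then show ?thesis by blast
  qed
  define p0 where "p0 = p - 2 * pi * of_int m"
  have p0: "0 \<le> p0" "p0 < 2 * pi" using m by (auto simp: p0_def)
  show ?thesis
  proof (cases "\<sigma> = 1")
    case True
    then show ?thesis using p0 by (intro red[of p0 m "(p0 + 2 * pi) / 2"]) (auto simp: p0_def)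
  next
    case False
    then have s: "\<sigma> = - 1" using \<sigma> by simp
    show ?thesis
    proof (cases "p0 = 0")
      case True
      \<comment> \<open>Moving left from 0 leaves the period, so 0 is represented by
        \<open>2 * pi\<close>.\<close>
      then have "p = 2 * pi + 2 * pi * of_int (m - 1)" by (simp add: p0_def algebra_simps)
      then show ?thesis using s by (intro red[of "2 * pi" "m - 1" pi]) auto
    next
      case False
      then show ?thesis using s p0 by (intro red[of p0 m "p0 / 2"]) (auto simp: p0_def)
    qed
  qed
qed

text \<open>The values at 0 and \<open>2 * pi\<close> agree, so strict concavity makes the value at
  \<open>pi\<close> larger. The chords from both ends to \<open>pi\<close> then force linear growth
  on either side of 0, and \<open>\<eta>\<close> is the sum of the two rates.\<close>

lemma kernel_cusp_at_zero:
  assumes K: "strictly_concave_kernel K" and fin: "K 0 \<noteq> - \<infinity>"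
  shows "\<exists>\<eta>>0. \<forall>\<^sub>F h in at_right 0. rk K h + rk K (- h) - 2 * rk K 0 \<ge> \<eta> * h"
proof -
  have K': "concave_kernel K" by (rule strictly_concave_kernelD[OF K])
  have dom: "kernel_domain K = {0..2 * pi}" by (rule kernel_domain_cases(2)[OF K' fin])
  have c: "concave_on {0..2 * pi} (rk K)" using concave_on_kernel_domain[OF K'] unfolding dom .
  have ends: "K (2 * pi) = K 0" "K (2 * pi - h) = K (- h)" for h
    by (rule kernel_period_end[OF K'])+
  define \<eta> where "\<eta> = 2 * (rk K pi - rk K 0) / pi"
  have "(1 - 1/2) * rk K 0 + 1/2 * rk K (2 * pi) < rk K ((1 - 1/2) * 0 + 1/2 * (2 * pi))"
    using strictly_concave_on_kernel_domain[OF K] unfolding dom by (rule strictly_concave_onD) auto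
  then have "\<eta> > 0" unfolding ends \<eta>_def by simp
  moreover have "rk K h + rk K (- h) - 2 * rk K 0 \<ge> \<eta> * h" if h: "0 < h" "h < pi" for h
  proof -
    have "(rk K pi - rk K 0) / (pi - 0) \<le> (rk K h - rk K 0) / (h - 0)"
      using h by (intro concave_on_slope_antimono[OF c]) auto
    then have 1: "(rk K pi - rk K 0) / pi * h \<le> rk K h - rk K 0" using h by (simp add: pos_le_divide_eq)
    have "(rk K (2 * pi - h) - rk K (2 * pi)) / (2 * pi - h - 2 * pi) \<le> (rk K pi - rk K (2 * pi)) / (pi - 2 * pi)"
      using h by (intro concave_on_slope_antimono[OF c]) auto
    then have "(rk K pi - rk K 0) / pi \<le> (rk K (- h) - rk K 0) / h"
      unfolding ends by simp
    then have 2: "(rk K pi - rk K 0) / pi * h \<le> rk K (- h) - rk K 0" using h by (simp add: pos_le_divide_eq)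
    have "\<eta> * h = (rk K pi - rk K 0) / pi * h + (rk K pi - rk K 0) / pi * h" by (simp add: \<eta>_def)
    then show ?thesis using 1 2 by linarith
  qed
  then have "\<forall>\<^sub>F h in at_right 0. rk K h + rk K (- h) - 2 * rk K 0 \<ge> \<eta> * h"
    unfolding eventually_at_right_field using pi_gt_zero by blast
  ultimately show ?thesis by blast
qed

text \<open>At an interior point differentiability makes the second difference o(h); at a multiple
  of the period the cusp makes it positive for small \<open>h\<close>.\<close>

lemma C1_kernel_second_difference:
  assumes Q: "strictly_concave_kernel Q" and C1: "C1_on_open_period Q" and fin: "Q p \<noteq> - \<infinity>" and \<epsilon>: "\<epsilon> > 0"
  shows "\<forall>\<^sub>F h in at_right 0. rk Q (p + h) + rk Q (p - h) - 2 * rk Q p \<ge> - \<epsilon> * h"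
proof -
  have Q': "concave_kernel Q" by (rule strictly_concave_kernelD[OF Q])
  obtain m :: int where m: "p - 2 * pi * of_int m \<in> {0..<2 * pi}" using reduce_mod_period by blast
  define p0 where "p0 = p - 2 * pi * of_int m"
  have per: "Q (p + s) = Q (p0 + s)" for s
  proof -
    have "p + s = (p0 + s) + 2 * pi * of_int m" by (simp add: p0_def)
    then show ?thesis using kernel_periodic[OF Q'] by (simp only:)
  qed
  have Qs: "Q p = Q p0" "Q (p - s) = Q (p0 - s)" for s using per[of 0] per[of "- s"] by simp_all
  have pos: "\<forall>\<^sub>F h in at_right (0::real). 0 < h" by (simp add: eventually_at_right_less)
  show ?thesis
  proof (cases "p0 = 0")
    case True
    then have "Q 0 \<noteq> - \<infinity>" using fin Qs by simp
    then obtain \<eta> where \<eta>: "\<eta> > 0" "\<forall>\<^sub>F h in at_right 0. rk Q h + rk Q (- h) - 2 * rk Q 0 \<ge> \<eta> * h"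
      using kernel_cusp_at_zero[OF Q] by blast
    from \<eta>(2) pos show ?thesis
    proof eventually_elim
      case (elim h)
      have "\<eta> * h > 0" "\<epsilon> * h > 0" using \<eta>(1) \<epsilon> elim by auto
      then show ?case using elim unfolding per Qs True by simp
    qed
  next
    case False
    then have "p0 \<in> {0<..<2 * pi}" using m by (auto simp: p0_def)
    then obtain D where D: "(rk Q has_real_derivative D) (at p0)"
      using C1 unfolding C1_on_open_period_def by blast
    then have lim: "((\<lambda>h. (rk Q (p0 + h) - rk Q p0) / h) \<longlongrightarrow> D) (at 0)" by (simp add: DERIV_def)
    have "((\<lambda>h. (rk Q (p0 + h) - rk Q p0) / h) \<longlongrightarrow> D) (at_right 0)"
      using lim filterlim_at_split by blast
    moreover have "filterlim (\<lambda>h. - h) (at 0) (at_right (0::real))"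
      unfolding filterlim_at by (auto intro!: tendsto_eq_intros simp: eventually_at_filter)
    then have "((\<lambda>h. (rk Q (p0 + - h) - rk Q p0) / - h) \<longlongrightarrow> D) (at_right 0)"
      by (rule filterlim_compose[OF lim])
    \<comment> \<open>The right and left quotients have the same limit, and their difference is the
      second difference divided by \<open>h\<close>.\<close>
    ultimately have "((\<lambda>h. (rk Q (p0 + h) - rk Q p0) / h - (rk Q (p0 + - h) - rk Q p0) / - h) \<longlongrightarrow> D - D) (at_right 0)"
      by (rule tendsto_diff)
    then have "\<forall>\<^sub>F h in at_right 0. (rk Q (p0 + h) - rk Q p0) / h - (rk Q (p0 + - h) - rk Q p0) / - h > - \<epsilon>"
      using \<epsilon> by (intro order_tendstoD(1)) auto
    with pos show ?thesis
    proof eventually_elim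
      case (elim h)
      then have "(rk Q (p0 + h) + rk Q (p0 - h) - 2 * rk Q p0) / h > - \<epsilon>"
        by (simp add: add_divide_distrib diff_divide_distrib)
      then show ?case unfolding per Qs using elim by (simp add: pos_less_divide_eq)
    qed
  qed
qed

text \<open>Under the steepness condition the single translate at the node outweighs the at most linear
  loss of all other terms; in the smooth case the cusp of the kernel makes the second difference
  of \<open>F\<close> positive.\<close>
lemma kernel_node_not_max:
  assumes L: "strictly_concave_kernel L" and K: "strictly_concave_kernel K"
    and cond: "cond_infty' K \<or> (C1_on_open_period K \<and> C1_on_open_period L)"
    and i: "i < length y" and node: "t - y ! i = 2 * pi * of_int m"
  shows "\<exists>s. Ffun L K y t < Ffun L K y s"
proof (rule ccontr)
  assume "\<not> ?thesis"
  then have max: "Ffun L K y s \<le> Ffun L K y t" for s by (simp add: not_less)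
  note L' = strictly_concave_kernelD[OF L] and K' = strictly_concave_kernelD[OF K]
  note fin = Ffun_real_at_max[OF L' K', of y t, OF max]
  define n where "n = length y"
  have per: "K (t - y ! i + s) = K s" for s
    unfolding node using kernel_periodic[OF K', of s m] by (simp add: add.commute)
  have K0: "K 0 \<noteq> - \<infinity>" using fin(2)[OF i] per[of 0] by simp
  have split: "(\<Sum>j<n. g j) = g i + (\<Sum>j\<in>{..<n} - {i}. g j)" for g :: "nat \<Rightarrow> real"
    using i by (subst sum.remove[of _ i]) (auto simp: n_def)
  have local: "\<exists>C. \<forall>\<^sub>F h in at_right 0. K (t - y ! j + \<sigma> * h) \<noteq> - \<infinity> \<and>
      rk K (t - y ! j + \<sigma> * h) - rk K (t - y ! j) \<ge> - C * h"
    if "j < n" "\<sigma> = 1 \<or> \<sigma> = - 1" for j \<sigma>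
    using that fin(2) unfolding n_def by (intro kernel_one_sided_linear_lower_bound[OF K'])
  have localL: "\<exists>C. \<forall>\<^sub>F h in at_right 0. L (t + \<sigma> * h) \<noteq> - \<infinity> \<and> rk L (t + \<sigma> * h) - rk L t \<ge> - C * h"
    if "\<sigma> = 1 \<or> \<sigma> = - 1" for \<sigma>
    using that fin(1) by (intro kernel_one_sided_linear_lower_bound[OF L'])
  have pos: "\<forall>\<^sub>F h in at_right (0::real). 0 < h" by (simp add: eventually_at_right_less)
  have real_at: "Ffun L K y s = ereal (rk L s + (\<Sum>j<n. rk K (s - y ! j)))"
    if "L s \<noteq> - \<infinity>" "\<And>j. j < n \<Longrightarrow> K (s - y ! j) \<noteq> - \<infinity>" for s
    unfolding n_def using that by (intro Ffun_real L' K') (auto simp: n_def)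
  have le: "rk L s + (\<Sum>j<n. rk K (s - y ! j)) \<le> rk L t + (\<Sum>j<n. rk K (t - y ! j))"
    if "L s \<noteq> - \<infinity>" "\<And>j. j < n \<Longrightarrow> K (s - y ! j) \<noteq> - \<infinity>" for s
    using max[of s] fin(3) real_at[of s, OF that] by (simp add: n_def)
  from cond show False
  proof
    assume "cond_infty' K"
    then obtain \<sigma> :: real where \<sigma>: "\<sigma> = 1 \<or> \<sigma> = - 1"
      and steep: "\<And>C. \<forall>\<^sub>F h in at_right 0. rk K (\<sigma> * h) - rk K 0 \<ge> C * h"
      using cond_infty'_steep_side[OF K' _ K0] by blast
    have "\<forall>j\<in>{..<n}. \<exists>C. \<forall>\<^sub>F h in at_right 0. K (t - y ! j + \<sigma> * h) \<noteq> - \<infinity> \<and>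
      rk K (t - y ! j + \<sigma> * h) - rk K (t - y ! j) \<ge> - C * h"
      using local[OF _ \<sigma>] by simp
    from bchoice[OF this] obtain C where
      C: "\<forall>j\<in>{..<n}. \<forall>\<^sub>F h in at_right 0. K (t - y ! j + \<sigma> * h) \<noteq> - \<infinity> \<and>
      rk K (t - y ! j + \<sigma> * h) - rk K (t - y ! j) \<ge> - C j * h" ..
    obtain CL where CL: "\<forall>\<^sub>F h in at_right 0. L (t + \<sigma> * h) \<noteq> - \<infinity> \<and> rk L (t + \<sigma> * h) - rk L t \<ge> - CL * h"
      using localL[OF \<sigma>] by blast
    \<comment> \<open>\<open>S\<close> bounds the rate of loss of \<open>L\<close> and all other
      translates; asking the steep translate for rate \<open>S + 1\<close> leaves a net gain of at
      least \<open>h\<close>.\<close>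
    define S where "S = CL + (\<Sum>j\<in>{..<n} - {i}. C j)"
    have "\<forall>\<^sub>F h in at_right 0. \<forall>j\<in>{..<n}. K (t - y ! j + \<sigma> * h) \<noteq> - \<infinity> \<and>
      rk K (t - y ! j + \<sigma> * h) - rk K (t - y ! j) \<ge> - C j * h"
      by (rule eventually_ball_finite[OF _ C]) simp
    with CL steep[of "S + 1"] pos have "\<forall>\<^sub>F h in at_right (0::real). False"
    proof eventually_elim
      case (elim h)
      have eq: "t + \<sigma> * h - y ! j = t - y ! j + \<sigma> * h" for j by simp
      have "rk L (t + \<sigma> * h) + (\<Sum>j<n. rk K (t - y ! j + \<sigma> * h)) \<le> rk L t + (\<Sum>j<n. rk K (t - y ! j))"
        using le[of "t + \<sigma> * h"] elim unfolding eq by auto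
      moreover have "(\<Sum>j\<in>{..<n} - {i}. rk K (t - y ! j + \<sigma> * h)) \<ge> (\<Sum>j\<in>{..<n} - {i}. rk K (t - y ! j) - C j * h)"
        using elim by (intro sum_mono) force
      moreover have "rk K (t - y ! i + \<sigma> * h) = rk K (\<sigma> * h)" "rk K (t - y ! i) = rk K 0"
        using per[of "\<sigma> * h"] per[of 0] by simp_all
      moreover have "(\<Sum>j\<in>{..<n} - {i}. rk K (t - y ! j) - C j * h) =
          (\<Sum>j\<in>{..<n} - {i}. rk K (t - y ! j)) - (S - CL) * h"
        by (simp add: S_def sum_subtractf sum_distrib_right)
      moreover have "rk L (t + \<sigma> * h) - rk L t \<ge> - CL * h" "rk K (\<sigma> * h) - rk K 0 \<ge> (S + 1) * h" "h > 0"
        using elim by auto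
      ultimately show False unfolding split by (simp add: algebra_simps)
    qed
    then show False by simp
  next
    assume C1: "C1_on_open_period K \<and> C1_on_open_period L"
    obtain \<eta> where \<eta>: "\<eta> > 0" "\<forall>\<^sub>F h in at_right 0. rk K h + rk K (- h) - 2 * rk K 0 \<ge> \<eta> * h"
      using kernel_cusp_at_zero[OF K K0] by blast
    \<comment> \<open>With this choice, \<open>L\<close> and the other translates together lose at
      most half of the gain \<open>\<eta> * h\<close> produced by the cusp.\<close>
    define \<epsilon> where "\<epsilon> = \<eta> / (2 * real (n + 1))"
    have \<epsilon>: "\<epsilon> > 0" using \<eta>(1) by (simp add: \<epsilon>_def)
    have fK: "\<forall>\<^sub>F h in at_right 0. \<forall>j\<in>{..<n}. K (t - y ! j + \<sigma> * h) \<noteq> - \<infinity>" if sg: "\<sigma> = 1 \<or> \<sigma> = - 1" for \<sigma>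
    proof (intro eventually_ball_finite ballI)
      fix j assume "j \<in> {..<n}"
      then obtain C where "\<forall>\<^sub>F h in at_right 0. K (t - y ! j + \<sigma> * h) \<noteq> - \<infinity> \<and>
          rk K (t - y ! j + \<sigma> * h) - rk K (t - y ! j) \<ge> - C * h" using local[OF _ sg] by blast
      then show "\<forall>\<^sub>F h in at_right 0. K (t - y ! j + \<sigma> * h) \<noteq> - \<infinity>" by (rule eventually_mono) simp
    qed simp
    have fL: "\<forall>\<^sub>F h in at_right 0. L (t + \<sigma> * h) \<noteq> - \<infinity>" if sg: "\<sigma> = 1 \<or> \<sigma> = - 1" for \<sigma>
    proof -
      obtain C where "\<forall>\<^sub>F h in at_right 0. L (t + \<sigma> * h) \<noteq> - \<infinity> \<and> rk L (t + \<sigma> * h) - rk L t \<ge> - C * h"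
        using localL[OF sg] by blast
      then show ?thesis by (rule eventually_mono) simp
    qed
    have dK: "\<forall>\<^sub>F h in at_right 0. \<forall>j\<in>{..<n}. rk K (t - y ! j + h) + rk K (t - y ! j - h) - 2 * rk K (t - y ! j) \<ge> - \<epsilon> * h"
      using C1 fin(2) \<epsilon> by (intro eventually_ball_finite ballI C1_kernel_second_difference[OF K]) (auto simp: n_def)
    have dL: "\<forall>\<^sub>F h in at_right 0. rk L (t + h) + rk L (t - h) - 2 * rk L t \<ge> - \<epsilon> * h"
      using C1 fin(1) \<epsilon> by (intro C1_kernel_second_difference[OF L]) auto
    note plus = disjI1[OF refl] and minus = disjI2[OF refl]
    from fK[OF plus] fK[OF minus] fL[OF plus] fL[OF minus] dK dL \<eta>(2) pos
    have "\<forall>\<^sub>F h in at_right (0::real). False"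
    proof eventually_elim
      case (elim h)
      have eq: "t + h - y ! j = t - y ! j + h" "t - h - y ! j = t - y ! j - h" for j by simp_all
      have a: "rk L (t + h) + (\<Sum>j<n. rk K (t - y ! j + h)) \<le> rk L t + (\<Sum>j<n. rk K (t - y ! j))"
        using le[of "t + h"] elim unfolding eq by auto
      have b: "rk L (t - h) + (\<Sum>j<n. rk K (t - y ! j - h)) \<le> rk L t + (\<Sum>j<n. rk K (t - y ! j))"
        using le[of "t - h"] elim unfolding eq by auto
      define \<Delta> where "\<Delta> j = rk K (t - y ! j + h) + rk K (t - y ! j - h) - 2 * rk K (t - y ! j)" for j
      have "(\<Sum>j<n. \<Delta> j) = (\<Sum>j<n. rk K (t - y ! j + h)) + (\<Sum>j<n. rk K (t - y ! j - h)) - 2 * (\<Sum>j<n. rk K (t - y ! j))"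
        by (simp add: \<Delta>_def sum.distrib sum_subtractf sum_distrib_left)
      then have "(\<Sum>j<n. \<Delta> j) + (rk L (t + h) + rk L (t - h) - 2 * rk L t) \<le> 0" using a b by linarith
      moreover have "rk L (t + h) + rk L (t - h) - 2 * rk L t \<ge> - \<epsilon> * h" using elim by auto
      moreover have "(\<Sum>j<n. \<Delta> j) = \<Delta> i + (\<Sum>j\<in>{..<n} - {i}. \<Delta> j)" by (rule split)
      moreover have "\<Delta> i \<ge> \<eta> * h"
      proof -
        have "\<Delta> i = rk K h + rk K (- h) - 2 * rk K 0"
          unfolding \<Delta>_def using per[of h] per[of "- h"] per[of 0] by simp
        then show ?thesis using elim by auto
      qed
      moreover have "(\<Sum>j\<in>{..<n} - {i}. \<Delta> j) \<ge> (\<Sum>j\<in>{..<n} - {i}. - \<epsilon> * h)"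
        using elim by (intro sum_mono) (auto simp: \<Delta>_def)
      moreover have "(\<Sum>j\<in>{..<n} - {i}. - \<epsilon> * h) \<ge> - (real n * \<epsilon> * h)"
      proof -
        have "card ({..<n} - {i}) \<le> n" by (metis card_lessThan card_mono Diff_subset finite_lessThan)
        then have "real (card ({..<n} - {i})) * (\<epsilon> * h) \<le> real n * (\<epsilon> * h)"
          using \<epsilon> elim by (intro mult_right_mono) auto
        then show ?thesis by (simp add: mult.assoc)
      qed
      ultimately have less: "\<eta> * h - real (n + 1) * \<epsilon> * h \<le> 0" by (simp add: algebra_simps)
      have "N * (\<eta> / (2 * N)) = \<eta> / 2" if "N > 0" for N :: real using that by simp
      from this[of "real (n + 1)"] have half: "real (n + 1) * \<epsilon> = \<eta> / 2" unfolding \<epsilon>_def by linarith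
      have "\<eta> * h \<le> 0" using less unfolding half by simp
      then show False using \<eta>(1) elim by (simp add: mult_le_0_iff)
    qed
    then show False by simp
  qed
qed

section \<open>Tangents on the node intervals\<close>

text \<open>For \<open>t\<close> in the \<open>j\<close>-th node interval this multiple of the period brings \<open>t - y\<^sub>i\<close> (\<open>y\<close> sorted and
  indexed from \<open>0\<close>) into \<open>[0, 2\<pi>]\<close>, where the kernel is concave.\<close>
definition period_shift :: "nat \<Rightarrow> nat \<Rightarrow> real" where
  "period_shift j i = (if i < j then 0 else 2 * pi)"

text \<open>At the maximum point \<open>z\<close> the slopes of the translates and the slope of
  \<open>L\<close> can be chosen with sum zero. Adding the tangent bounds then cancels all
  dependence on \<open>t\<close> and leaves a bound linear in the displacement of the nodes. It is
  strict because either \<open>t\<close> differs from \<open>z\<close>, or some node has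
  moved.\<close>

lemma Ffun_tangent:
  assumes L: "strictly_concave_kernel L" and K: "strictly_concave_kernel K"
    and z: "z \<in> {0..2 * pi}" and max: "\<And>s. s \<in> {0..2 * pi} \<Longrightarrow> Ffun L K w s \<le> Ffun L K w z"
    and inn: "\<And>i. i < length w \<Longrightarrow> z - w ! i + period_shift j i \<in> {0<..<2 * pi}"
    and \<mu>: "Ffun L K w z = ereal \<mu>"
  shows "\<exists>\<kappa>. \<forall>x t. length x = length w \<longrightarrow> x \<noteq> w \<longrightarrow> t \<in> {0..2 * pi} \<longrightarrow>
    (\<forall>i<length w. t - x ! i + period_shift j i \<in> {0..2 * pi}) \<longrightarrow>
    Ffun L K x t < ereal (\<mu> - (\<Sum>i<length w. \<kappa> i * (x ! i - w ! i)))"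
proof -
  note L' = strictly_concave_kernelD[OF L] and K' = strictly_concave_kernelD[OF K]
  define n where "n = length w"
  define p where "p i = period_shift j i" for i
  have Kp: "K (a + p i) = K a" for a i
    using concave_kernelD(1)[OF K', of a] by (simp add: p_def period_shift_def)
  note fin = Ffun_real_at_max[OF L' K', of w z, OF max]
  have zd: "z \<in> kernel_domain L" using z fin(1) by (simp add: kernel_domain_def)
  \<comment> \<open>The open interval on which the shifted argument of translate \<open>i\<close>
    stays inside one period, so that this translate is concave there.\<close>
  define B where "B i = {w ! i - p i <..< w ! i - p i + 2 * pi}" for i
  define f where "f i r = rk K (r - w ! i + p i)" for i r
  have Bin: "r \<in> B i \<longleftrightarrow> r - w ! i + p i \<in> {0<..<2 * pi}" for r i by (auto simp: B_def)
  have f_eq: "f i r = rk K (r - w ! i)" for i r by (simp add: f_def Kp)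
  have \<mu>_eq: "\<mu> = rk L z + (\<Sum>i<n. f i z)" using fin(3) \<mu> by (simp add: f_eq n_def)
  have "\<exists>\<kappa>. (\<forall>r\<in>kernel_domain L. rk L r \<le> rk L z - (\<Sum>i<n. \<kappa> i) * (r - z)) \<and>
             (\<forall>i\<in>{..<n}. \<forall>r\<in>B i. f i r \<le> f i z + \<kappa> i * (r - z))"
  proof (rule concave_family_max_supergradients[OF _ concave_on_kernel_domain[OF L'] zd])
    fix i assume "i \<in> {..<n}"
    moreover have "concave_on (B i) (f i)"
    proof (rule concave_on_realI)
      show "convex (B i)" by (simp add: B_def convex_real_interval)
      fix x y u :: real assume *: "x \<in> B i" "y \<in> B i" "0 \<le> u" "u \<le> 1"
      have "(1 - u) * (x - w ! i + p i) + u * (y - w ! i + p i) = (1 - u) * x + u * y - w ! i + p i"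
        by (simp add: algebra_simps)
      then show "(1 - u) * f i x + u * f i y \<le> f i ((1 - u) * x + u * y)"
        using concave_onD[OF concave_kernelD(4)[OF K'] *(3,4)] * unfolding f_def Bin by fastforce
    qed
    ultimately show "open (B i) \<and> concave_on (B i) (f i) \<and> z \<in> B i"
      using inn[of i] Bin[of z i] by (simp add: B_def n_def p_def)
  next
    fix r assume r: "r \<in> kernel_domain L" "\<And>i. i \<in> {..<n} \<Longrightarrow> r \<in> B i"
    have "K (r - w ! i) \<noteq> - \<infinity>" if "i < n" for i
      using concave_kernelD(3)[OF K', of "r - w ! i + p i"] r(2)[of i] that unfolding Bin Kp by simp
    then have "Ffun L K w r = ereal (rk L r + (\<Sum>i<n. f i r))"
      using r(1) unfolding f_eq n_def by (intro Ffun_real[OF L' K']) (auto simp: kernel_domain_def)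
    then show "rk L r + (\<Sum>i<n. f i r) \<le> rk L z + (\<Sum>i<n. f i z)"
      using max[of r] r(1) \<mu> \<mu>_eq by (simp add: kernel_domain_def)
  qed simp
  then obtain \<kappa> where \<kappa>L: "\<And>r. r \<in> kernel_domain L \<Longrightarrow> rk L r \<le> rk L z + (- (\<Sum>i<n. \<kappa> i)) * (r - z)"
    and \<kappa>K: "\<And>i r. i < n \<Longrightarrow> r \<in> B i \<Longrightarrow> f i r \<le> f i z + \<kappa> i * (r - z)" by auto
  show ?thesis
  proof (intro exI[of _ \<kappa>] allI impI)
    fix x t assume len: "length x = length w" and ne: "x \<noteq> w" and t: "t \<in> {0..2 * pi}"
      and ins: "\<forall>i<length w. t - x ! i + period_shift j i \<in> {0..2 * pi}"
    show "Ffun L K x t < ereal (\<mu> - (\<Sum>i<length w. \<kappa> i * (x ! i - w ! i)))"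
    proof (cases "L t = - \<infinity> \<or> (\<exists>i<length x. K (t - x ! i) = - \<infinity>)")
      case True
      then show ?thesis using Ffun_eq_MInf[OF L' K'] by simp
    next
      case False
      then have finx: "L t \<noteq> - \<infinity>" "\<And>i. i < n \<Longrightarrow> K (t - x ! i) \<noteq> - \<infinity>" by (auto simp: n_def len)
      then have Fx: "Ffun L K x t = ereal (rk L t + (\<Sum>i<n. rk K (t - x ! i)))"
        unfolding n_def len[symmetric] by (intro Ffun_real[OF L' K']) (auto simp: len)
      \<comment> \<open>Displacement of node \<open>i\<close>; the argument of its translate changes
        by \<open>(t - z) - d i\<close>.\<close>
      define d where "d i = x ! i - w ! i" for i
      have Lstrict: "rk L t < rk L z - (\<Sum>i<n. \<kappa> i) * (t - z)" if "t \<noteq> z"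
      proof -
        have "L t < ereal (rk L z + (- (\<Sum>i<n. \<kappa> i)) * (t - z))"
          using \<kappa>L kernel_open_domain[OF L'] t that by (intro kernel_tangent_strict[OF L zd]) auto
        then show ?thesis by (subst (asm) kernel_real[OF L' finx(1)]) simp
      qed
      have Kstrict: "rk K (t - x ! i) < f i z + \<kappa> i * ((t - z) - d i)" if i: "i < n" and "t - z \<noteq> d i" for i
      proof -
        define s where "s = z - w ! i + p i"
        have s: "s \<in> {0<..<2 * pi}" using inn i by (simp add: s_def p_def n_def)
        have "K (t - x ! i + p i) < ereal (rk K s + \<kappa> i * ((t - x ! i + p i) - s))"
        proof (rule kernel_tangent_strict[OF K])
          show "s \<in> kernel_domain K" using s kernel_open_domain[OF K'] by blast
          show "t - x ! i + p i \<in> {0..2 * pi}" using ins i by (simp add: p_def n_def)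
          show "t - x ! i + p i \<noteq> s" using that by (simp add: s_def d_def)
          fix r assume "r \<in> {0<..<2 * pi}"
          then have "f i (r + w ! i - p i) \<le> f i z + \<kappa> i * (r + w ! i - p i - z)"
            using i by (intro \<kappa>K) (auto simp: Bin)
          then show "rk K r \<le> rk K s + \<kappa> i * (r - s)" by (simp add: f_def s_def algebra_simps)
        qed
        then have "K (t - x ! i) < ereal (f i z + \<kappa> i * ((t - z) - d i))"
          unfolding Kp by (simp add: s_def f_def d_def algebra_simps)
        then show ?thesis by (subst (asm) kernel_real[OF K' finx(2)[OF i]]) simp
      qed
      have Kweak: "rk K (t - x ! i) \<le> f i z + \<kappa> i * ((t - z) - d i)" if i: "i < n" for i
      proof (cases "t - z = d i")
        case True
        then have "t - x ! i = z - w ! i" by (simp add: d_def)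
        then show ?thesis using True by (simp add: f_eq)
      qed (use Kstrict[OF i] in simp)
      have "rk L t + (\<Sum>i<n. rk K (t - x ! i)) <
        (rk L z - (\<Sum>i<n. \<kappa> i) * (t - z)) + (\<Sum>i<n. f i z + \<kappa> i * ((t - z) - d i))"
      proof (cases "t = z")
        case False
        then show ?thesis using Lstrict Kweak by (intro add_less_le_mono sum_mono) auto
      next
        case True
        obtain i where i: "i < n" "x ! i \<noteq> w ! i" using ne len by (auto simp: n_def list_eq_iff_nth_eq)
        then have "(\<Sum>i<n. rk K (t - x ! i)) < (\<Sum>i<n. f i z + \<kappa> i * ((t - z) - d i))"
          using Kstrict[OF i(1)] Kweak True by (intro sum_strict_mono_ex1) (auto simp: d_def)
        then show ?thesis using True by simp
      qed
      \<comment> \<open>The terms in \<open>t - z\<close> from \<open>L\<close> and from the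
        translates cancel.\<close>
      also have "\<dots> = \<mu> - (\<Sum>i<n. \<kappa> i * d i)"
        by (simp add: \<mu>_eq sum.distrib sum_subtractf right_diff_distrib sum_distrib_right)
      finally show ?thesis unfolding Fx d_def n_def by simp
    qed
  qed
qed

section \<open>Nodes, node intervals and their maxima\<close>

lemma torus_ptsD:
  assumes "x \<in> torus_pts n"
  shows "length x = n" "i < n \<Longrightarrow> sort x ! i \<in> {0..<2 * pi}" "sort x \<in> torus_pts n"
proof -
  show l: "length x = n" using assms by (simp add: torus_pts_def)
  show "sort x ! i \<in> {0..<2 * pi}" if "i < n"
  proof -
    have "sort x ! i \<in> set (sort x)" using that l by (intro nth_mem) simp
    then show ?thesis using assms by (auto simp: torus_pts_def)
  qed
  show "sort x \<in> torus_pts n" using assms by (auto simp: torus_pts_def)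
qed

lemma nodes_simps:
  assumes "x \<in> torus_pts n"
  shows "nodes x ! 0 = 0" "nodes x ! Suc n = 2 * pi" "i < n \<Longrightarrow> nodes x ! Suc i = sort x ! i"
    "length (nodes x) = Suc (Suc n)"
  using torus_ptsD(1)[OF assms] by (auto simp: nodes_def nth_append)

lemma nodes_mono:
  assumes x: "x \<in> torus_pts n" and ij: "i \<le> j" "j \<le> Suc n"
  shows "nodes x ! i \<le> nodes x ! j"
proof -
  have "sorted (nodes x)" unfolding nodes_def
    using x by (auto simp: sorted_append torus_pts_def less_imp_le)
  then show ?thesis using ij nodes_simps(4)[OF x] by (simp add: sorted_nth_mono)
qed

text \<open>Justifies \<open>period_shift\<close>: coordinates with index below \<open>j\<close> lie
  to the left of interval \<open>j\<close>, the others to its right. Interval \<open>j\<close>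
  starts at node \<open>j\<close>, which is coordinate \<open>j - 1\<close> when
  \<open>j > 0\<close>, since the node list begins with 0.\<close>

lemma node_interval_bounds:
  assumes x: "x \<in> torus_pts n" and j: "j \<le> n" and t: "t \<in> {nodes x ! j..nodes x ! (j + 1)}"
  shows "t \<in> {0..2 * pi}" "i < n \<Longrightarrow> t - sort x ! i + period_shift j i \<in> {0..2 * pi}"
proof -
  have "nodes x ! 0 \<le> nodes x ! j" "nodes x ! (j + 1) \<le> nodes x ! Suc n"
    using j by (auto intro!: nodes_mono[OF x])
  then show t2: "t \<in> {0..2 * pi}" using t nodes_simps[OF x] by auto
  assume i: "i < n"
  have s: "sort x ! i = nodes x ! Suc i" using nodes_simps(3)[OF x i] by simp
  show "t - sort x ! i + period_shift j i \<in> {0..2 * pi}"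
  proof (cases "i < j")
    case True
    then have "nodes x ! Suc i \<le> nodes x ! j" using j by (auto intro!: nodes_mono[OF x])
    then show ?thesis using True t t2 torus_ptsD(2)[OF x i] s by (auto simp: period_shift_def)
  next
    case False
    then have "nodes x ! (j + 1) \<le> nodes x ! Suc i" using i by (auto intro!: nodes_mono[OF x])
    then show ?thesis using False t t2 torus_ptsD(2)[OF x i] s by (auto simp: period_shift_def)
  qed
qed

text \<open>When nodes coincide, the last one not exceeding \<open>t\<close> is chosen; its
  successor is strictly larger. Thus every maximum point can be assigned to a nondegenerate
  interval.\<close>

lemma nondegenerate_interval_cover:
  assumes x: "x \<in> torus_pts n" and t: "t \<in> {0..2 * pi}"
  obtains j where "j \<le> n" "t \<in> {nodes x ! j..nodes x ! (j + 1)}" "nodes x ! j < nodes x ! (j + 1)"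
proof -
  define A where "A = {j. j \<le> n \<and> nodes x ! j \<le> t \<and> nodes x ! j < 2 * pi}"
  have fA: "finite A" and A0: "0 \<in> A" using t nodes_simps(1)[OF x] by (auto simp: A_def)
  define j where "j = Max A"
  have jA: "j \<in> A" unfolding j_def using fA A0 by (intro Max_in) auto
  have "t \<le> nodes x ! (j + 1) \<and> nodes x ! j < nodes x ! (j + 1)"
  proof (cases "j = n")
    case True
    then show ?thesis using nodes_simps(2)[OF x] t jA by (auto simp: A_def)
  next
    case False
    then have "j + 1 \<le> n" using jA by (auto simp: A_def)
    moreover have "j + 1 \<notin> A" using Max_ge[OF fA, of "j + 1"] by (auto simp: j_def)
    moreover have "nodes x ! (j + 1) \<le> 2 * pi"
      using nodes_mono[OF x, of "j + 1" "Suc n"] nodes_simps(2)[OF x] \<open>j + 1 \<le> n\<close> by simp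
    ultimately show ?thesis using jA t by (auto simp: A_def)
  qed
  then show ?thesis using that[of j] jA by (auto simp: A_def)
qed

lemma Ffun_le_interval_max:
  assumes "t \<in> {nodes x ! j..nodes x ! (j + 1)}"
  shows "Ffun L K x t \<le> interval_max L K x j"
  unfolding interval_max_def using assms by (rule SUP_upper)

lemma interval_max_attained:
  assumes L: "concave_kernel L" and K: "concave_kernel K" and x: "x \<in> torus_pts n" and j: "j \<le> n"
  obtains t where "t \<in> {nodes x ! j..nodes x ! (j + 1)}" "interval_max L K x j = Ffun L K x t"
proof -
  have "nodes x ! j \<le> nodes x ! (j + 1)" using j by (intro nodes_mono[OF x]) auto
  then obtain t where t: "t \<in> {nodes x ! j..nodes x ! (j + 1)}"
      "\<And>s. s \<in> {nodes x ! j..nodes x ! (j + 1)} \<Longrightarrow> Ffun L K x s \<le> Ffun L K x t"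
    using Ffun_attains_sup_on[OF L K] by blast
  then have "interval_max L K x j = Ffun L K x t"
    unfolding interval_max_def by (intro antisym SUP_least SUP_upper) auto
  then show ?thesis using that t(1) by blast
qed

lemma m_upper_eq_SUP:
  assumes L: "concave_kernel L" and K: "concave_kernel K" and x: "x \<in> torus_pts n"
  shows "m_upper L K x = (SUP t. Ffun L K x t)"
proof (rule antisym)
  have len: "length x = n" by (rule torus_ptsD(1)[OF x])
  show "m_upper L K x \<le> (SUP t. Ffun L K x t)"
    unfolding m_upper_def interval_max_def by (auto intro!: Max.boundedI SUP_least SUP_upper)
  obtain t where t: "t \<in> {0..2 * pi}" "\<And>s. Ffun L K x s \<le> Ffun L K x t"
    using Ffun_attains_sup[OF L K] by blast
  obtain j where j: "j \<le> n" "t \<in> {nodes x ! j..nodes x ! (j + 1)}"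
    using nondegenerate_interval_cover[OF x t(1)] by blast
  have "(SUP t. Ffun L K x t) \<le> Ffun L K x t" using t(2) by (intro SUP_least)
  also have "\<dots> \<le> interval_max L K x j" by (rule Ffun_le_interval_max[OF j(2)])
  also have "\<dots> \<le> m_upper L K x" unfolding m_upper_def len using j(1) by (intro Max_ge) auto
  finally show "(SUP t. Ffun L K x t) \<le> m_upper L K x" .
qed

section \<open>The minimizer\<close>

text \<open>The third claim is the source of uniqueness: by the second, any other sorted minimizer
  would have all its interval maxima equal to \<open>M_val L K n\<close>.\<close>

lemma minimizer_properties:
  assumes L: "strictly_concave_kernel L" and K: "strictly_concave_kernel K"
    and cond: "cond_infty' K \<or> (C1_on_open_period K \<and> C1_on_open_period L)"
    and w: "w \<in> torus_pts n" "sorted w" and M: "M_val L K n = (SUP t. Ffun L K w t)"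
  shows "\<forall>j\<le>n. nodes w ! j < nodes w ! (j + 1)"
    and "\<forall>j\<le>n. interval_max L K w j = M_val L K n"
    and "\<forall>x\<in>torus_pts n. sort x \<noteq> w \<longrightarrow> (\<exists>j\<le>n. interval_max L K x j < M_val L K n)"
proof -
  note L' = strictly_concave_kernelD[OF L] and K' = strictly_concave_kernelD[OF K]
  have len: "length w = n" by (rule torus_ptsD(1)[OF w(1)])
  have sw: "sort w = w" using w(2) by (simp add: sorted_sort_id)
  obtain t0 where t0: "t0 \<in> {0..2 * pi}" "\<And>s. Ffun L K w s \<le> Ffun L K w t0"
    using Ffun_attains_sup[OF L' K'] by blast
  have M0: "M_val L K n = Ffun L K w t0" unfolding M using t0(2) by (intro antisym SUP_least SUP_upper) auto
  obtain \<mu> where \<mu>: "M_val L K n = ereal \<mu>" using Ffun_real_at_max(3)[OF L' K' t0(2)] M0 by metis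
  have le: "Ffun L K w s \<le> ereal \<mu>" for s using t0(2) M0 \<mu> by metis
  \<comment> \<open>Minimality of \<open>w\<close> also holds against lists outside the box, so
    perturbations need be neither sorted nor reduced.\<close>
  have ge: "\<exists>t\<in>{0..2 * pi}. ereal \<mu> \<le> Ffun L K y t" if "length y = n" for y
  proof -
    obtain y' where y': "y' \<in> torus_pts (length y)" "\<And>t. Ffun L K y' t = Ffun L K y t"
      using Ffun_torus_representative[OF K'] by blast
    obtain t where t: "t \<in> {0..2 * pi}" "\<And>s. Ffun L K y s \<le> Ffun L K y t"
      using Ffun_attains_sup[OF L' K'] by blast
    have "ereal \<mu> \<le> (SUP t. Ffun L K y' t)"
      unfolding \<mu>[symmetric] M_val_def using y'(1) that by (intro INF_lower) simp
    also have "\<dots> \<le> Ffun L K y t" unfolding y'(2) using t(2) by (intro SUP_least)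
    finally show ?thesis using t(1) by blast
  qed
  define I where "I j = {nodes w ! j..nodes w ! (j + 1)}" for j
  have inn: "z - w ! i + period_shift j i \<in> {0<..<2 * pi}"
    if "j \<le> n" "z \<in> I j" "Ffun L K w z = ereal \<mu>" "i < n" for j z i
  proof -
    have "z - w ! i + period_shift j i \<in> {0..2 * pi}"
      using node_interval_bounds(2)[OF w(1) that(1) _ that(4)] that(2) unfolding I_def sw by blast
    moreover have "z - w ! i \<noteq> 2 * pi * of_int m" for m
      using kernel_node_not_max[OF L K cond, of i w z m] that(3,4) le len by (metis not_le)
    \<comment> \<open>The shifted difference equals 0 or \<open>2 * pi\<close> only if the unshifted
      one is -1, 0 or 1 times the period; in each case \<open>z\<close> would coincide with a node
      modulo the period.\<close>
    from this[of 0] this[of 1] this[of "- 1"] have "z - w ! i + period_shift j i \<noteq> 0"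
      "z - w ! i + period_shift j i \<noteq> 2 * pi"
      by (auto simp: period_shift_def)
    ultimately show ?thesis by simp
  qed
  define J where "J = {j. j \<le> n \<and> nodes w ! j < nodes w ! (j + 1) \<and> (\<exists>z\<in>I j. Ffun L K w z = ereal \<mu>)}"
  have finJ: "finite J" unfolding J_def by simp
  have max_in_J: "\<exists>j\<in>J. t \<in> I j" if t: "t \<in> {0..2 * pi}" "Ffun L K w t = ereal \<mu>" for t
  proof -
    obtain j where "j \<le> n" "t \<in> I j" "nodes w ! j < nodes w ! (j + 1)"
      unfolding I_def by (rule nondegenerate_interval_cover[OF w(1) t(1)])
    then show ?thesis using t(2) by (intro bexI[of _ j]) (auto simp: J_def)
  qed
  have "\<forall>j\<in>J. \<exists>\<kappa>. \<forall>x t. length x = length w \<longrightarrow> x \<noteq> w \<longrightarrow> t \<in> {0..2 * pi} \<longrightarrow>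
    (\<forall>i<length w. t - x ! i + period_shift j i \<in> {0..2 * pi}) \<longrightarrow>
    Ffun L K x t < ereal (\<mu> - (\<Sum>i<length w. \<kappa> i * (x ! i - w ! i)))"
  proof
    fix j assume "j \<in> J"
    then obtain z where z: "j \<le> n" "z \<in> I j" "Ffun L K w z = ereal \<mu>" unfolding J_def by blast
    show "\<exists>\<kappa>. \<forall>x t. length x = length w \<longrightarrow> x \<noteq> w \<longrightarrow> t \<in> {0..2 * pi} \<longrightarrow>
      (\<forall>i<length w. t - x ! i + period_shift j i \<in> {0..2 * pi}) \<longrightarrow>
      Ffun L K x t < ereal (\<mu> - (\<Sum>i<length w. \<kappa> i * (x ! i - w ! i)))"
    proof (rule Ffun_tangent[OF L K _ _ _ z(3)])
      show "z \<in> {0..2 * pi}" using node_interval_bounds(1)[OF w(1) z(1)] z(2) unfolding I_def by blast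
      show "Ffun L K w s \<le> Ffun L K w z" for s unfolding z(3) by (rule le)
      show "z - w ! i + period_shift j i \<in> {0<..<2 * pi}" if "i < length w" for i
        using inn[OF z] that len by simp
    qed
  qed
  from bchoice[OF this] obtain \<kappa> where \<kappa>: "\<forall>j\<in>J. \<forall>x t. length x = length w \<longrightarrow> x \<noteq> w \<longrightarrow> t \<in> {0..2 * pi} \<longrightarrow>
    (\<forall>i<length w. t - x ! i + period_shift j i \<in> {0..2 * pi}) \<longrightarrow>
    Ffun L K x t < ereal (\<mu> - (\<Sum>i<length w. \<kappa> j i * (x ! i - w ! i)))" ..
  have tangent: "Ffun L K x t < ereal (\<mu> - (\<Sum>i<n. \<kappa> j i * (x ! i - w ! i)))"
    if "j \<in> J" "length x = n" "x \<noteq> w" "t \<in> {0..2 * pi}"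
      "\<And>i. i < n \<Longrightarrow> t - x ! i + period_shift j i \<in> {0..2 * pi}" for j x t
    using bspec[OF \<kappa> that(1), rule_format, of x t] that len by simp
  \<comment> \<open>Otherwise small moves along \<open>v\<close> yield configurations
    \<open>Y m\<close> whose maximum points accumulate at some \<open>t\<close>. By continuity
    \<open>t\<close> is a maximum point of \<open>w\<close>, hence lies in an interval of
    \<open>J\<close>, and the tangent bound of that interval pushes the perturbed maximum below
    \<open>\<mu>\<close>.\<close>
  have no_descent: "\<exists>j\<in>J. (\<Sum>i<n. \<kappa> j i * v i) < 0" if v: "\<exists>i\<in>{..<n}. v i \<noteq> 0" for v
  proof (rule ccontr)
    assume "\<not> ?thesis"
    then have nonneg: "(\<Sum>i<n. \<kappa> j i * v i) \<ge> 0" if "j \<in> J" for j using that by (auto simp: not_less)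
    define Y where "Y m = map (\<lambda>i. w ! i + v i / real (Suc m)) [0..<n]" for m
    have lenY: "length (Y m) = n" for m by (simp add: Y_def)
    have Yi: "Y m ! i = w ! i + v i / real (Suc m)" if "i < n" for m i using that by (simp add: Y_def)
    have Yw: "Y m \<noteq> w" for m
    proof -
      obtain i where "i < n" "v i \<noteq> 0" using v by auto
      then have "Y m ! i \<noteq> w ! i" by (simp add: Yi)
      then show ?thesis by auto
    qed
    have "\<forall>m. \<exists>t. t \<in> {0..2 * pi} \<and> ereal \<mu> \<le> Ffun L K (Y m) t" using ge[OF lenY] by blast
    then obtain T where T: "\<And>m. T m \<in> {0..2 * pi}" "\<And>m. ereal \<mu> \<le> Ffun L K (Y m) (T m)" by metis
    obtain t r where t: "t \<in> {0..2 * pi}" and r: "strict_mono r" "(T \<circ> r) \<longlonglongrightarrow> t"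
      using compact_imp_seq_compact[OF compact_Icc, of 0 "2 * pi"] T(1) unfolding seq_compact_def by metis
    have Tr: "(\<lambda>m. T (r m)) \<longlonglongrightarrow> t" using r(2) by (simp add: o_def)
    have Ylim: "(\<lambda>m. Y (r m) ! i) \<longlonglongrightarrow> w ! i" if "i < n" for i
    proof -
      have "(\<lambda>m. v i / real (Suc m)) \<longlonglongrightarrow> 0"
        unfolding divide_inverse by (rule tendsto_mult_right_zero[OF LIMSEQ_inverse_real_of_nat])
      from LIMSEQ_subseq_LIMSEQ[OF this r(1)] have "(\<lambda>m. w ! i + v i / real (Suc (r m))) \<longlonglongrightarrow> w ! i + 0"
        by (intro tendsto_add tendsto_const) (simp add: o_def)
      then show ?thesis by (simp add: Yi[OF that])
    qed
    have "(\<lambda>m. Ffun L K (Y (r m)) (T (r m))) \<longlonglongrightarrow> Ffun L K w t"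
      using Ylim by (intro tendsto_Ffun[OF L' K' Tr]) (auto simp: len lenY)
    then have "ereal \<mu> \<le> Ffun L K w t" by (rule LIMSEQ_le_const) (use T(2) in blast)
    then have tmax: "Ffun L K w t = ereal \<mu>" using le[of t] by (rule antisym[rotated])
    then obtain j where j: "j \<in> J" "t \<in> I j" using max_in_J[OF t] by blast
    have jn: "j \<le> n" using j(1) by (simp add: J_def)
    \<comment> \<open>The shift conditions hold strictly at the limit, so they persist for late
      \<open>m\<close> and the tangent bound for this \<open>j\<close> applies.\<close>
    have "\<forall>\<^sub>F m in sequentially. \<forall>i\<in>{..<n}. T (r m) - Y (r m) ! i + period_shift j i \<in> {0<..<2 * pi}"
    proof (intro eventually_ball_finite ballI)
      fix i assume "i \<in> {..<n}"
      then have i: "i < n" by simp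
      have "(\<lambda>m. T (r m) - Y (r m) ! i + period_shift j i) \<longlonglongrightarrow> t - w ! i + period_shift j i"
        using Tr Ylim[OF i] by (intro tendsto_intros)
      then show "\<forall>\<^sub>F m in sequentially. T (r m) - Y (r m) ! i + period_shift j i \<in> {0<..<2 * pi}"
        by (rule topological_tendstoD[OF _ open_greaterThanLessThan inn[OF jn j(2) tmax i]])
    qed simp
    then obtain m where m: "\<forall>i\<in>{..<n}. T (r m) - Y (r m) ! i + period_shift j i \<in> {0<..<2 * pi}"
      by (auto simp: eventually_sequentially)
    have "T (r m) - Y (r m) ! i + period_shift j i \<in> {0..2 * pi}" if "i < n" for i
      using bspec[OF m, of i] that by simp
    then have "Ffun L K (Y (r m)) (T (r m)) < ereal (\<mu> - (\<Sum>i<n. \<kappa> j i * (Y (r m) ! i - w ! i)))"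
      by (intro tangent j(1) lenY Yw T(1))
    also have "(\<Sum>i<n. \<kappa> j i * (Y (r m) ! i - w ! i)) = (\<Sum>i<n. \<kappa> j i * v i) / real (Suc (r m))"
      unfolding sum_divide_distrib by (intro sum.cong) (auto simp: Yi)
    also have "ereal (\<mu> - \<dots>) \<le> ereal \<mu>" using nonneg[OF j(1)] by simp
    finally show False using T(2)[of "r m"] by simp
  qed
  have J: "J = {..n}"
  proof (rule card_subset_eq)
    show "J \<subseteq> {..n}" by (auto simp: J_def)
    have "J \<noteq> {}" using max_in_J[OF t0(1)] M0 \<mu> by auto
    then have "card J \<noteq> 0" using finJ by simp
    \<comment> \<open>At most \<open>n\<close> vectors would admit a direction forbidden by
      \<open>no_descent\<close>. For \<open>n = 0\<close> there are no directions, and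
      \<open>J\<close> being nonempty is enough.\<close>
    moreover have "\<not> card J \<le> n" if "n \<noteq> 0"
    proof
      assume "card J \<le> n"
      then obtain v where "\<exists>i\<in>{..<n}. v i \<noteq> 0" "\<forall>j\<in>J. (\<Sum>i<n. \<kappa> j i * v i) \<ge> 0"
        using few_halfspaces_common_direction[OF finJ, of "{..<n}" \<kappa>] \<open>n \<noteq> 0\<close> by force
      then show False using no_descent[of v] by force
    qed
    moreover have "card J \<le> Suc n" using card_mono[OF _ \<open>J \<subseteq> {..n}\<close>] by simp
    ultimately show "card J = card {..n}" by (cases "n = 0") auto
  qed simp
  show "\<forall>j\<le>n. nodes w ! j < nodes w ! (j + 1)" using J by (auto simp: J_def)
  show "\<forall>j\<le>n. interval_max L K w j = M_val L K n"
  proof (intro allI impI antisym)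
    fix j assume "j \<le> n"
    then have "j \<in> J" using J by simp
    then obtain z where "z \<in> I j" "Ffun L K w z = ereal \<mu>" by (auto simp: J_def)
    then show "M_val L K n \<le> interval_max L K w j"
      using Ffun_le_interval_max[of z w j L K] unfolding \<mu> I_def by simp
    show "interval_max L K w j \<le> M_val L K n" unfolding \<mu> interval_max_def using le by (intro SUP_least)
  qed
  have "\<exists>l. (\<forall>j\<in>{..n}. l j \<ge> 0) \<and> (\<exists>j\<in>{..n}. l j > 0) \<and> (\<forall>i\<in>{..<n}. (\<Sum>j\<in>{..n}. l j * \<kappa> j i) = 0)"
    using no_descent unfolding J by (intro no_common_direction_imp_positive_relation) auto
  then obtain l where l: "\<And>j. j \<le> n \<Longrightarrow> l j \<ge> 0" "\<exists>j\<in>{..n}. l j > 0"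
      "\<And>i. i < n \<Longrightarrow> (\<Sum>j\<le>n. l j * \<kappa> j i) = 0" by auto
  show "\<forall>x\<in>torus_pts n. sort x \<noteq> w \<longrightarrow> (\<exists>j\<le>n. interval_max L K x j < M_val L K n)"
  proof (intro ballI impI, rule ccontr)
    fix x assume x: "x \<in> torus_pts n" "sort x \<noteq> w" and "\<not> (\<exists>j\<le>n. interval_max L K x j < M_val L K n)"
    then have large: "ereal \<mu> \<le> interval_max L K x j" if "j \<le> n" for j using that \<mu> by (metis not_le)
    \<comment> \<open>If every interval maximum of \<open>x\<close> reached \<open>\<mu>\<close>,
      the tangent bounds would make every \<open>A j\<close> negative, whereas their average with
      the weights \<open>l\<close> vanishes.\<close>
    define A where "A j = (\<Sum>i<n. \<kappa> j i * (sort x ! i - w ! i))" for j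
    have neg: "A j < 0" if j: "j \<le> n" for j
    proof -
      obtain t where t: "t \<in> {nodes x ! j..nodes x ! (j + 1)}" "interval_max L K x j = Ffun L K x t"
        using interval_max_attained[OF L' K' x(1) j] by blast
      have "ereal \<mu> \<le> Ffun L K (sort x) t" using large[OF j] t(2) Ffun_mset[of "sort x" x] by simp
      also have "\<dots> < ereal (\<mu> - A j)"
        unfolding A_def
        using J j x node_interval_bounds[OF x(1) j t(1)] torus_ptsD(1)[OF x(1)] by (intro tangent) auto
      finally show ?thesis by simp
    qed
    have "(\<Sum>j\<le>n. l j * A j) = (\<Sum>i<n. (\<Sum>j\<le>n. l j * \<kappa> j i) * (sort x ! i - w ! i))"
      unfolding A_def sum_distrib_left sum_distrib_right by (subst sum.swap) (simp add: mult_ac)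
    also have "\<dots> = 0" using l(3) by simp
    finally have "(\<Sum>j\<le>n. l j * A j) = 0" .
    moreover have "(\<Sum>j\<le>n. l j * A j) < (\<Sum>j\<le>n. 0)"
    proof (rule sum_strict_mono_ex1)
      show "\<forall>j\<in>{..n}. l j * A j \<le> 0" using l(1) less_imp_le[OF neg] by (auto intro!: mult_nonneg_nonpos)
      show "\<exists>j\<in>{..n}. l j * A j < 0" using l(2) neg by (auto intro!: mult_pos_neg)
    qed simp
    ultimately show False by simp
  qed
qed

section \<open>The equidistant configuration in the case \<open>L = K\<close>\<close>

definition equidistant_pts :: "nat \<Rightarrow> real list" where
  "equidistant_pts n = map (\<lambda>k. 2 * pi * real k / real (n + 1)) [1..<n + 1]"

lemma equidistant_pts:
  shows "equidistant_pts n \<in> torus_pts n" "sorted (equidistant_pts n)"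
    "k \<le> Suc n \<Longrightarrow> nodes (equidistant_pts n) ! k = 2 * pi * real k / real (n + 1)"
    "set (0 # equidistant_pts n) = {2 * pi * real k / real (n + 1) | k. k \<le> n}"
proof -
  show t: "equidistant_pts n \<in> torus_pts n"
    by (auto simp: equidistant_pts_def torus_pts_def divide_simps)
  show s: "sorted (equidistant_pts n)"
    unfolding equidistant_pts_def sorted_map
    by (rule sorted_wrt_mono_rel[OF _ sorted_upt]) (simp add: divide_right_mono)
  show "nodes (equidistant_pts n) ! k = 2 * pi * real k / real (n + 1)" if k: "k \<le> Suc n"
  proof -
    consider "k = 0" | "k = Suc n" | i where "k = Suc i" "i < n"
      using k by (cases k) force+
    then show ?thesis
    proof cases
      case 3
      then have "nodes (equidistant_pts n) ! k = equidistant_pts n ! i"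
        using nodes_simps(3)[OF t] s by (simp add: sorted_sort_id)
      then show ?thesis using 3 by (simp add: equidistant_pts_def del: upt_Suc)
    qed (use nodes_simps[OF t] in auto)
  qed
  show "set (0 # equidistant_pts n) = {2 * pi * real k / real (n + 1) | k. k \<le> n}"
  proof -
    have "{2 * pi * real k / real (n + 1) | k. k \<le> n} = (\<lambda>k. 2 * pi * real k / real (n + 1)) ` {..n}" by auto
    also have "{..n} = insert 0 {1..<n + 1}" by auto
    finally show ?thesis by (simp add: equidistant_pts_def del: upt_Suc)
  qed
qed

text \<open>With \<open>L = K\<close> the field is a sum over \<open>n + 1\<close> equally spaced
  translates, the one at 0 coming from \<open>L\<close>; a shift by one step permutes them
  cyclically.\<close>

lemma Ffun_equidistant_shift:
  assumes K: "concave_kernel K"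
  shows "Ffun K K (equidistant_pts n) (t + 2 * pi / real (n + 1)) = Ffun K K (equidistant_pts n) t"
proof -
  define h where "h = 2 * pi / real (n + 1)"
  have F: "Ffun K K (equidistant_pts n) t = (\<Sum>k\<le>n. K (t - h * real k))" for t
  proof -
    have "Ffun K K (equidistant_pts n) t = K t + (\<Sum>j<n. K (t - h * real (Suc j)))"
      unfolding Ffun_def by (simp add: equidistant_pts_def h_def del: upt_Suc)
    also have "\<dots> = (\<Sum>k<Suc n. K (t - h * real k))" by (subst sum.lessThan_Suc_shift) simp
    finally show ?thesis by (simp only: lessThan_Suc_atMost)
  qed
  have "(\<Sum>k\<le>n. K (t + h - h * real k)) = (\<Sum>k<Suc n. K (t + h - h * real k))"
    by (simp only: lessThan_Suc_atMost)
  also have "\<dots> = K (t + h) + (\<Sum>k<n. K (t - h * real k))"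
    by (subst sum.lessThan_Suc_shift) (simp add: algebra_simps)
  \<comment> \<open>The translate moved out at the front returns as the last one, because
    \<open>n + 1\<close> steps make a full period.\<close>
  also have "K (t + h) = K (t - h * real n)"
  proof -
    have "h * real (n + 1) = 2 * pi" by (simp add: h_def)
    then have "t + h = t - h * real n + 2 * pi" by (simp add: algebra_simps)
    then show ?thesis using concave_kernelD(1)[OF K, of "t - h * real n"] by (simp only:)
  qed
  also have "K (t - h * real n) + (\<Sum>k<n. K (t - h * real k)) = (\<Sum>k\<le>n. K (t - h * real k))"
    by (simp add: add.commute flip: lessThan_Suc_atMost)
  finally show ?thesis unfolding F h_def .
qed

text \<open>One step of the rotation carries each node interval onto the next without changing
  \<open>F\<close>.\<close>

lemma equidistant_pts_equioscillate:
  assumes K: "concave_kernel K" and "k \<le> n"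
  shows "interval_max K K (equidistant_pts n) k = interval_max K K (equidistant_pts n) 0"
  using assms(2)
proof (induction k)
  case (Suc k)
  define h where "h = 2 * pi / real (n + 1)"
  define F where "F = Ffun K K (equidistant_pts n)"
  have node: "nodes (equidistant_pts n) ! i = h * real i" if "i \<le> Suc n" for i
    using equidistant_pts(3)[OF that] by (simp add: h_def)
  have shift: "(\<lambda>t. t + h) ` {h * real k..h * real (Suc k)} = {h * real (Suc k)..h * real (Suc (Suc k))}"
    by (simp add: algebra_simps)
  have "interval_max K K (equidistant_pts n) (Suc k) = (SUP t\<in>{h * real (Suc k)..h * real (Suc (Suc k))}. F t)"
    unfolding interval_max_def F_def using node Suc.prems by simp
  also have "\<dots> = (SUP t\<in>{h * real k..h * real (Suc k)}. F (t + h))"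
    by (simp only: shift[symmetric] image_image)
  also have "\<dots> = interval_max K K (equidistant_pts n) k"
    unfolding interval_max_def F_def h_def Ffun_equidistant_shift[OF K] using node Suc.prems by (simp add: h_def)
  finally show ?case using Suc by simp
qed simp

section \<open>Uniqueness, minimax equality, sandwich property and equidistant nodes\<close>

theorem theorem11p6:
  fixes L K :: "real \<Rightarrow> ereal" and n :: nat
  assumes "strictly_concave_kernel L" and "strictly_concave_kernel K"
    and "cond_infty' K \<or> (C1_on_open_period K \<and> C1_on_open_period L)"
  shows "\<exists>w\<in>torus_pts n.
     M_val L K n = (SUP t. Ffun L K w t) \<and>
     (\<forall>w'\<in>torus_pts n. M_val L K n = (SUP t. Ffun L K w' t) \<longrightarrow> mset w' = mset w) \<and>
     distinct (0 # w) \<and>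
     (\<forall>k\<le>n. interval_max L K w k = interval_max L K w 0) \<and>
     M_val L K n = (INF y\<in>torus_pts n. m_upper L K y) \<and>
     (INF y\<in>torus_pts n. m_upper L K y) = (SUP y\<in>torus_pts n. m_lower L K y) \<and>
     (SUP y\<in>torus_pts n. m_lower L K y) = m_val L K n \<and>
     (\<forall>x\<in>torus_pts n. \<forall>y\<in>torus_pts n.
        m_lower L K x \<le> m_val L K n \<and> m_val L K n = M_val L K n \<and> M_val L K n \<le> m_upper L K y) \<and>
     (L = K \<longrightarrow> set (0 # w) = {2 * pi * real k / real (n + 1) | k. k \<le> n})"
proof -
  note L' = strictly_concave_kernelD[OF assms(1)] and K' = strictly_concave_kernelD[OF assms(2)]
  have sort_min: "M_val L K n = (SUP t. Ffun L K (sort y) t)" if "M_val L K n = (SUP t. Ffun L K y t)" for y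
    unfolding that using Ffun_mset[of y "sort y"] by simp
  obtain w0 where w0: "w0 \<in> torus_pts n" "M_val L K n = (SUP t. Ffun L K w0 t)"
    using M_val_attained[OF L' K'] by blast
  define w where "w = sort w0"
  have w: "w \<in> torus_pts n" "sorted w" "M_val L K n = (SUP t. Ffun L K w t)"
    unfolding w_def using torus_ptsD(3)[OF w0(1)] sort_min[OF w0(2)] by auto
  note props = minimizer_properties[OF assms w]
  have sw: "sort w = w" using w(2) by (simp add: sorted_sort_id)
  have len: "length w = n" by (rule torus_ptsD(1)[OF w(1)])
  have lower_less: "m_lower L K x < M_val L K n" if x: "x \<in> torus_pts n" "sort x \<noteq> w" for x
  proof -
    obtain j where j: "j \<le> n" "interval_max L K x j < M_val L K n" using props(3) x by blast
    have "m_lower L K x \<le> interval_max L K x j"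
      unfolding m_lower_def torus_ptsD(1)[OF x(1)] using j(1) by (intro Min_le) auto
    then show ?thesis using j(2) by simp
  qed
  have const_lower: "m_lower L K x = c" if "x \<in> torus_pts n" "\<And>j. j \<le> n \<Longrightarrow> interval_max L K x j = c" for x c
  proof -
    have "interval_max L K x ` {0..n} = {c}" using that(2) by force
    then show ?thesis unfolding m_lower_def torus_ptsD(1)[OF that(1)] by simp
  qed
  have lower_w: "m_lower L K w = M_val L K n" using props(2) w(1) by (intro const_lower) auto
  have lower_le: "m_lower L K x \<le> M_val L K n" if x: "x \<in> torus_pts n" for x
  proof (cases "sort x = w")
    case True
    have "interval_max L K x j = interval_max L K w j" for j
      unfolding interval_max_def nodes_def True[symmetric] using Ffun_mset[of x "sort x"]
      by (simp add: sorted_sort_id)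
    then show ?thesis using props(2) x const_lower[of x "M_val L K n"] by simp
  qed (use lower_less[OF x] in simp)
  have m: "m_val L K n = M_val L K n"
    unfolding m_val_def using lower_le lower_w w(1) by (metis (no_types, lifting) SUP_eqI)
  have up: "M_val L K n = (INF y\<in>torus_pts n. m_upper L K y)"
    unfolding M_val_def using m_upper_eq_SUP[OF L' K'] by (intro INF_cong) auto
  \<comment> \<open>A second minimizer, once sorted, equioscillates at the level M, so its lower
    value is M; by \<open>lower_less\<close> only \<open>w\<close> has this property.\<close>
  have unique: "mset w' = mset w" if w': "w' \<in> torus_pts n" "M_val L K n = (SUP t. Ffun L K w' t)" for w'
  proof -
    have "sort w' \<in> torus_pts n" "sorted (sort w')" using torus_ptsD(3)[OF w'(1)] by auto
    from minimizer_properties(2)[OF assms this sort_min[OF w'(2)]]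
    have "m_lower L K (sort w') = M_val L K n"
      using torus_ptsD(3)[OF w'(1)] by (intro const_lower) auto
    then have "sort w' = w" using lower_less[OF torus_ptsD(3)[OF w'(1)]]
      by (auto simp: sorted_sort_id)
    then show ?thesis by (metis mset_sort)
  qed
  \<comment> \<open>All node intervals of \<open>w\<close> are nondegenerate, so 0 and the sorted
    coordinates increase strictly and are distinct.\<close>
  have "sorted_wrt (<) (0 # w)"
    unfolding sorted_wrt_iff_nth_Suc_transp[OF transp_on_less]
  proof (intro allI impI)
    fix i assume "Suc i < length (0 # w)"
    then have "i < n" by (simp add: len)
    have nth: "(0 # w) ! k = nodes w ! k" if "k \<le> n" for k
      using that nodes_simps[OF w(1)] sw by (cases k) auto
    show "(0 # w) ! i < (0 # w) ! Suc i"
      unfolding nth[OF less_imp_le[OF \<open>i < n\<close>]] nth[OF Suc_leI[OF \<open>i < n\<close>]]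
      using props(1) \<open>i < n\<close> by simp
  qed
  then have distinct: "distinct (0 # w)" by (simp only: strict_sorted_iff)
  \<comment> \<open>For the equidistant configuration the lower and upper values coincide. The upper
    value is at least M, while the lower value of anything but \<open>w\<close> is below M.\<close>
  have equi: "set (0 # w) = {2 * pi * real k / real (n + 1) | k. k \<le> n}" if "L = K"
  proof -
    define e where "e = equidistant_pts n"
    note e = equidistant_pts[of n, folded e_def]
    define c where "c = interval_max L K e 0"
    have c: "interval_max L K e j = c" if "j \<le> n" for j
      unfolding c_def e_def \<open>L = K\<close> by (rule equidistant_pts_equioscillate[OF K' that])
    have "interval_max L K e ` {0..n} = {c}" using c by force
    then have "m_upper L K e = c" unfolding m_upper_def torus_ptsD(1)[OF e(1)] by simp
    moreover have "M_val L K n \<le> m_upper L K e" unfolding up using e(1) by (rule INF_lower)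
    moreover have "m_lower L K e = c" using c e(1) by (intro const_lower) auto
    ultimately have "sort e = w" using lower_less[OF e(1)] by force
    then have "e = w" using e(2) by (simp add: sorted_sort_id)
    then show ?thesis using e(4) by simp
  qed
  show ?thesis
  proof (intro bexI[of _ w] conjI ballI impI allI w(1) w(3) distinct up)
    show "mset w' = mset w" if "w' \<in> torus_pts n" "M_val L K n = (SUP t. Ffun L K w' t)" for w'
      by (rule unique[OF that])
    show "interval_max L K w k = interval_max L K w 0" if "k \<le> n" for k using props(2) that by simp
    show "(INF y\<in>torus_pts n. m_upper L K y) = (SUP y\<in>torus_pts n. m_lower L K y)"
      using up m by (simp add: m_val_def)
    show "(SUP y\<in>torus_pts n. m_lower L K y) = m_val L K n" by (simp add: m_val_def)
    show "m_lower L K x \<le> m_val L K n" if "x \<in> torus_pts n" for x using lower_le[OF that] m by simp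
    show "m_val L K n = M_val L K n" by (rule m)
    show "M_val L K n \<le> m_upper L K y" if "y \<in> torus_pts n" for y
      unfolding up using that by (rule INF_lower)
  qed (rule equi)
qed

end
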